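(* Let $G$ be a finite $p$-subgroup of the Nottingham group $\mathcal N(k)\subset\mathrm{Aut}(k[[t]])$. There are elements $\bar f_0,\dots,\bar f_s\in k[[t]][t^{-1}]$ acted on by $G$ in terms of the cohomology classes $\bar C_i$ of the HKG-cover associated with $G$, i.e. $\sigma(\bar f_i)=\bar f_i+\bar C_i(\sigma)$ for $\sigma\in G$, where $\sigma\mapsto\bar C_i(\sigma)\in k_{\mathbf n,\bar m_i}[\bar f_0,\dots,\bar f_{i-1}]$ are the cocycles described in the context, and a local uniformizer $t'=(\bar f_s)^{-1/m}$ of $k[[t]]$, such that $$\sigma(t')=t'\big(1+\bar C_s(\sigma)(t')^m\big)^{-1/m}\in k[[t']]=k[[t]]\qquad\text{for every }\sigma\in G.$$
   Context: $k$ is an algebraically closed field of characteristic $p\ge5$. $\mathcal N(k)$ is the group of $k$-automorphisms of $k[[t]]$ with $t\mapsto t+\sum_{i\ge2}a_it^i$. An HKG-cover (with $p$-group) is a Galois cover $X\to\mathbb P^1$ over $k$ with Galois group a finite $p$-group and with a unique ramified point $P\in X$, which is totally and wildly ramified. By Harbater and Katz–Gabber, a finite $p$-subgroup $G\subset\mathrm{Aut}(k[[t]])$ is associated with an HKG-cover $X\to\mathbb P^1$ with group $G$ such that the $G$-action on the completed local ring $\hat{\mathcal O}_{X,P}\cong k[[t]]$ is the given one; thus $F=k(X)\subset k((t))$. The pole numbers at $P$ are $0=m_0<m_1<\cdots$; $m=m_r$ is the first one not divisible by $p$. Let $\rho_i:G\to\mathrm{GL}(L(m_iP))$, $0\le i\le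 r$ ($\rho_r$ is faithful), and let $c_1<\dots<c_s$ be the indices with $\ker\rho_{c_i}\supsetneq\ker\rho_{c_i+1}$. Set $F_i=F^{\ker\rho_{c_i}}$ ($1\le i\le s$), $F_{s+1}=F$, $\bar m_i=m_{c_i+1}$, and let $\bar f_i$ be a function with polar divisor $\bar m_iP$, so that $F_{i+1}=F_i(\bar f_i)$; $\bar f_0$ is a generator of $F_1=F^G=k(\bar f_0)$ with pole only at $P$, of order $\bar m_0=|G|$. One has $\bar m_s=m$. Each $\mathrm{Gal}(F_{i+1}/F_i)\cong(\mathbb Z/p\mathbb Z)^{n_i}$, and $k_{\mathbf n,\bar m_i}[\bar f_0,\dots,\bar f_{i-1}]$ is the $k$-span of monomials $\bar f_0^{a_0}\cdots\bar f_{i-1}^{a_{i-1}}$ with $a_0\geq 0$, $0\le a_j<p^{n_j}$ for $j\ge1$ and $\sum_\nu a_\nu\bar m_\nu<\bar m_i$; it equals $L((\bar m_i-1)P)$. The maps $\sigma\mapsto\bar C_i(\sigma)=\sigma(\bar f_i)-\bar f_i$ are $1$-cocycles of $G$ with values in this $G$-module. The power $(1+x)^{-1/m}$ for $x\in tk[[t]]$ is the binomial series $\sum_\nu\binom{-1/m}{\nu}x^\nu$; since $p\nmid m$, $m$-th roots of units exist in $k[[t]]$.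
   Formalization: The formal theorem assumes that m̄_s = m and that k_{n,m̄_i}[f̄_0,…,f̄_{i-1}] = L((m̄_i−1)P) for 1≤i≤s; the context asserts both for every HKG-cover, but they can fail: for p=5, y^5−y=x^3, w^5−w=x^4 one has m̄_s=20<m and no such t' exists. *)

theory Defs
  imports
    "HOL-Computational_Algebra.Computational_Algebra"
    "HOL-Algebra.Group"
    "HOL-Library.Infinite_Set"
begin

text \<open>
  Throughout, \<open>k\<close> is the field of the type \<open>'k\<close>, \<open>k[[t]]\<close> is the type \<open>'k fps\<close> and
  \<open>k((t))\<close> is the type \<open>'k fls\<close>.
\<close>

definition nottingham :: "('k::field fps \<Rightarrow> 'k fps) set" where
  "nottingham = {\<sigma>. bij \<sigma> \<and>
     (\<forall>a b. \<sigma> (a + b) = \<sigma> a + \<sigma> b) \<and> (\<forall>a b. \<sigma> (a * b) = \<sigma> a * \<sigma> b) \<and>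
     (\<forall>c. \<sigma> (fps_const c) = fps_const c) \<and>
     \<sigma> fps_X $ 0 = 0 \<and> \<sigma> fps_X $ 1 = 1}"

definition nottingham_group :: "('k::field fps \<Rightarrow> 'k fps) monoid" where
  "nottingham_group = \<lparr>carrier = nottingham, mult = (\<lambda>\<sigma> \<tau>. \<sigma> \<circ> \<tau>), one = id\<rparr>"

text \<open>
  The unique extension of an automorphism of \<open>k[[t]]\<close> to the fraction field \<open>k((t))\<close>:
  a Laurent series of order \<open>n\<close> is written as \<open>t\<^sup>n\<close> times a unit power series
  (\<open>n\<close> may be negative).
\<close>
definition act :: "('k::field fps \<Rightarrow> 'k fps) \<Rightarrow> 'k fls \<Rightarrow> 'k fls" where
  "act \<sigma> f = fps_to_fls (\<sigma> (fls_base_factor_to_fps f))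
              * fps_to_fls (\<sigma> fps_X) powi fls_subdegree f"

definition is_k_subfield :: "'k::field fls set \<Rightarrow> bool" where
  "is_k_subfield F \<longleftrightarrow> range fls_const \<subseteq> F \<and>
     (\<forall>a\<in>F. \<forall>b\<in>F. a - b \<in> F \<and> a * b \<in> F) \<and> (\<forall>a\<in>F. inverse a \<in> F)"

definition k_adjoin :: "'k::field fls \<Rightarrow> 'k fls set" where
  "k_adjoin x = \<Inter>{E. is_k_subfield E \<and> x \<in> E}"

definition fixed_field :: "('k::field fps \<Rightarrow> 'k fps) set \<Rightarrow> 'k fls set \<Rightarrow> 'k fls set" where
  "fixed_field H F = {f \<in> F. \<forall>\<sigma>\<in>H. act \<sigma> f = f}"

definition Gal :: "'k::field fls set \<Rightarrow> 'k fls set \<Rightarrow> ('k fls \<Rightarrow> 'k fls) set" where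
  "Gal E M = {\<phi> \<in> extensional E. bij_betw \<phi> E E \<and>
     (\<forall>a\<in>E. \<forall>b\<in>E. \<phi> (a + b) = \<phi> a + \<phi> b \<and> \<phi> (a * b) = \<phi> a * \<phi> b) \<and>
     (\<forall>a\<in>M. \<phi> a = a)}"

text \<open>
  A smooth projective curve over \<open>k\<close> is given by its function field \<open>F\<close>; its points are the
  places of \<open>F/k\<close>, represented by their valuation rings.
\<close>
definition is_place :: "'k::field fls set \<Rightarrow> 'k fls set \<Rightarrow> bool" where
  "is_place F R \<longleftrightarrow> R \<subset> F \<and> range fls_const \<subseteq> R \<and>
     (\<forall>a\<in>R. \<forall>b\<in>R. a - b \<in> R \<and> a * b \<in> R) \<and> (\<forall>a\<in>F. a \<in> R \<or> inverse a \<in> R)"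

definition max_ideal :: "'k::field fls set \<Rightarrow> 'k fls set" where
  "max_ideal R = {a \<in> R. a = 0 \<or> inverse a \<notin> R}"

definition uniformizer_of :: "'k::field fls set \<Rightarrow> 'k fls \<Rightarrow> bool" where
  "uniformizer_of R \<pi> \<longleftrightarrow> \<pi> \<in> max_ideal R \<and> (\<forall>a\<in>max_ideal R. \<exists>b\<in>R. a = b * \<pi>)"

text \<open>
  For a place \<open>R\<close> of \<open>F\<close> and a subfield \<open>E\<close> over which \<open>F\<close> is finite, both places are
  discrete, and \<open>e\<close> is unique. All residue fields are \<open>k\<close> when \<open>k\<close> is algebraically
  closed, so unramified means \<open>e = 1\<close>.
\<close>
definition ramification_index :: "'k::field fls set \<Rightarrow> 'k fls set \<Rightarrow> nat" where
  "ramification_index E R = (THE e. \<exists>\<pi> u v. uniformizer_of R \<pi> \<and> uniformizer_of (R \<inter> E) u \<and>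
     v \<in> R \<and> v \<noteq> 0 \<and> inverse v \<in> R \<and> u = v * \<pi> ^ e)"

definition place_P :: "'k::field fls set \<Rightarrow> 'k fls set" where
  "place_P F = F \<inter> range fps_to_fls"

text \<open>
  \<open>F \<subseteq> k((t))\<close> is the function field of an HKG-cover of the projective line associated
  with \<open>G\<close>. The density condition says that the completion of the local ring at \<open>P\<close> is
  \<open>k[[t]]\<close>; as the action of \<open>G\<close> on \<open>F\<close> is the restriction of its action on \<open>k((t))\<close>,
  the action on this completion is the given one, and \<open>G\<close> acts faithfully on \<open>F\<close>. By Artin's
  theorem \<open>F\<close> is then Galois over \<open>F\<^sup>G\<close> with group \<open>G\<close>. For a nontrivial \<open>p\<close>-group \<open>G\<close>,
  total ramification at \<open>P\<close> is wild; the trivial group, where nothing ramifies, is allowed.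
\<close>
definition hkg_cover :: "('k::field fps \<Rightarrow> 'k fps) set \<Rightarrow> 'k fls set \<Rightarrow> bool" where
  "hkg_cover G F \<longleftrightarrow>
     is_k_subfield F \<and> (\<forall>\<sigma>\<in>G. \<forall>f\<in>F. act \<sigma> f \<in> F) \<and>
     (\<exists>x. x \<notin> range fls_const \<and> fixed_field G F = k_adjoin x) \<and>
     (\<forall>g n. \<exists>h. fps_to_fls h \<in> F \<and> (\<forall>j<n. h $ j = g $ j)) \<and>
     ramification_index (fixed_field G F) (place_P F) = card G \<and>
     (\<forall>R. is_place F R \<and> R \<noteq> place_P F \<longrightarrow> ramification_index (fixed_field G F) R = 1)"

definition regular_outside_P :: "'k::field fls set \<Rightarrow> 'k fls set" where
  "regular_outside_P F = {f \<in> F. \<forall>R. is_place F R \<and> R \<noteq> place_P F \<longrightarrow> f \<in> R}"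

definition LP :: "'k::field fls set \<Rightarrow> nat \<Rightarrow> 'k fls set" where
  "LP F n = {f \<in> regular_outside_P F. f = 0 \<or> - int n \<le> fls_subdegree f}"

definition has_polar_divisor :: "'k::field fls set \<Rightarrow> 'k fls \<Rightarrow> nat \<Rightarrow> bool" where
  "has_polar_divisor F f n \<longleftrightarrow>
     f \<in> regular_outside_P F \<and> f \<noteq> 0 \<and>
     (if n = 0 then fls_subdegree f \<ge> 0 else fls_subdegree f = - int n)"

definition pole_number :: "'k::field fls set \<Rightarrow> nat \<Rightarrow> nat" where
  "pole_number F = enumerate {n. \<exists>f. has_polar_divisor F f n}"

definition r_index :: "'k::field fls set \<Rightarrow> nat" where
  "r_index F = (LEAST i. \<not> CHAR('k) dvd pole_number F i)"

definition m_pole :: "'k::field fls set \<Rightarrow> nat" where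
  "m_pole F = pole_number F (r_index F)"

definition ker_rho :: "('k::field fps \<Rightarrow> 'k fps) set \<Rightarrow> 'k fls set \<Rightarrow> nat \<Rightarrow> ('k fps \<Rightarrow> 'k fps) set" where
  "ker_rho G F i = {\<sigma> \<in> G. \<forall>f\<in>LP F (pole_number F i). act \<sigma> f = f}"

definition jumps :: "('k::field fps \<Rightarrow> 'k fps) set \<Rightarrow> 'k fls set \<Rightarrow> nat set" where
  "jumps G F = {i. i < r_index F \<and> ker_rho G F (Suc i) \<subset> ker_rho G F i}"

definition s_num :: "('k::field fps \<Rightarrow> 'k fps) set \<Rightarrow> 'k fls set \<Rightarrow> nat" where
  "s_num G F = card (jumps G F)"

text \<open>\<open>c\<^sub>i\<close>, meaningful for \<open>1 \<le> i \<le> s\<close>.\<close>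
definition c_index :: "('k::field fps \<Rightarrow> 'k fps) set \<Rightarrow> 'k fls set \<Rightarrow> nat \<Rightarrow> nat" where
  "c_index G F i = sorted_list_of_set (jumps G F) ! (i - 1)"

text \<open>\<open>F\<^sub>i\<close>, meaningful for \<open>1 \<le> i \<le> s + 1\<close>.\<close>
definition F_step :: "('k::field fps \<Rightarrow> 'k fps) set \<Rightarrow> 'k fls set \<Rightarrow> nat \<Rightarrow> 'k fls set" where
  "F_step G F i =
     (if i = s_num G F + 1 then F else fixed_field (ker_rho G F (c_index G F i)) F)"

definition m_bar :: "('k::field fps \<Rightarrow> 'k fps) set \<Rightarrow> 'k fls set \<Rightarrow> nat \<Rightarrow> nat" where
  "m_bar G F i = (if i = 0 then card G else pole_number F (Suc (c_index G F i)))"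

text \<open>
  The exponent \<open>n\<^sub>i\<close> of the elementary abelian group \<open>Gal(F\<^sub>i\<^sub>+\<^sub>1/F\<^sub>i)\<close>, read off from
  its order.
\<close>
definition n_exp :: "('k::field fps \<Rightarrow> 'k fps) set \<Rightarrow> 'k fls set \<Rightarrow> nat \<Rightarrow> nat" where
  "n_exp G F i = (THE n. card (Gal (F_step G F (Suc i)) (F_step G F i)) = CHAR('k) ^ n)"

definition hkg_generators ::
  "('k::field fps \<Rightarrow> 'k fps) set \<Rightarrow> 'k fls set \<Rightarrow> (nat \<Rightarrow> 'k fls) \<Rightarrow> bool" where
  "hkg_generators G F f \<longleftrightarrow>
     fixed_field G F = k_adjoin (f 0) \<and>
     (\<forall>i\<le>s_num G F. has_polar_divisor F (f i) (m_bar G F i))"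

text \<open>
  The \<open>k\<close>-span of the monomials in \<open>f 0, \<dots>, f (i - 1)\<close> of weight less than \<open>m_bar G F i\<close>;
  the exponent of \<open>f 0\<close> is unrestricted. For \<open>i = 0\<close> this is the space of constants.
\<close>
definition monomial_span ::
  "('k::field fps \<Rightarrow> 'k fps) set \<Rightarrow> 'k fls set \<Rightarrow> (nat \<Rightarrow> 'k fls) \<Rightarrow> nat \<Rightarrow> 'k fls set" where
  "monomial_span G F f i = module.span (\<lambda>c g. fls_const c * g)
     {\<Prod>j<i. f j ^ a j | a.
        (\<forall>j. 1 \<le> j \<and> j < i \<longrightarrow> a j < CHAR('k) ^ n_exp G F j) \<and>
        (\<Sum>j<i. a j * m_bar G F j) < m_bar G F i}"

definition is_1_cocycle ::
  "('k::field fps \<Rightarrow> 'k fps) set \<Rightarrow> 'k fls set \<Rightarrow> (('k fps \<Rightarrow> 'k fps) \<Rightarrow> 'k fls) \<Rightarrow> bool" where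
  "is_1_cocycle G M C \<longleftrightarrow>
     (\<forall>\<sigma>\<in>G. \<forall>x\<in>M. act \<sigma> x \<in> M) \<and> (\<forall>\<sigma>\<in>G. C \<sigma> \<in> M) \<and>
     (\<forall>\<sigma>\<in>G. \<forall>\<tau>\<in>G. C (\<sigma> \<circ> \<tau>) = C \<sigma> + act \<sigma> (C \<tau>))"

text \<open>
  The binomial coefficients of a rational exponent \<open>a\<close> whose denominator is prime to the
  characteristic have denominators prime to the characteristic, and are mapped to \<open>k\<close> by
  reduction. The library's binomial series is available only in characteristic \<open>0\<close>.
\<close>
definition reduce_rat :: "rat \<Rightarrow> 'k::field" where
  "reduce_rat q = of_int (fst (quotient_of q)) / of_int (snd (quotient_of q))"

definition binomial_series :: "rat \<Rightarrow> 'k::field fps" where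
  "binomial_series a = Abs_fps (\<lambda>n. reduce_rat (a gchoose n))"

end

theory Submission
  imports Defs
begin

unbundle fps_syntax

text \<open>
  Write \<open>F\<^sup>G = k(y)\<close> with \<open>y\<close> having a pole at \<open>P\<close>. Then \<open>1/y\<close> is a uniformizer of \<open>k(y)\<close> at
  \<open>P\<close>, so total ramification gives the pole order \<open>|G|\<close>, and \<open>y\<close> is regular elsewhere since the
  valuation ring at \<open>P\<close> is integral over its \<open>G\<close>-invariants; this is \<open>f\<^sub>0\<close>. An element of order
  one in \<open>F\<close>, multiplied by a suitable polynomial in \<open>y\<close>, is regular outside \<open>P\<close>, so some pole number
  is prime to \<open>p\<close>. As \<open>G\<close> preserves leading coefficients, \<open>\<sigma> f\<^sub>i - f\<^sub>i\<close> has a smaller pole than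
  \<open>f\<^sub>i\<close>. Finally, for \<open>t' = f\<^sub>s\<^bsup>-1/m\<^esup>\<close> both sides of the formula have
  the same \<open>m\<close>-th power and the same leading coefficient, and \<open>m\<close> is invertible in \<open>k\<close>.
\<close>

section \<open>The action on Laurent series\<close>

text \<open>Membership in \<open>nottingham\<close> does not mention continuity; it is automatic.
  Splitting off constant terms repeatedly shows that \<open>\<sigma> g\<close> and the substitution
  agree modulo every power of \<open>\<sigma> fps_X\<close>, whose constant term is 0.\<close>

lemma nottingham_compose:
  assumes "\<sigma> \<in> nottingham"
  shows "\<sigma> g = g oo \<sigma> fps_X"
proof (rule fps_ext)
  fix n
  from assms have add: "\<sigma> (a + b) = \<sigma> a + \<sigma> b" and mult: "\<sigma> (a * b) = \<sigma> a * \<sigma> b"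
    and const: "\<sigma> (fps_const c) = fps_const c" and s0: "\<sigma> fps_X $ 0 = 0" for a b c
    by (auto simp: nottingham_def)
  have "\<sigma> fps_X ^ n dvd \<sigma> g - (g oo \<sigma> fps_X)" for n g
  proof (induction n arbitrary: g)
    case (Suc n)
    have g: "g = fps_X * fps_shift 1 g + fps_const (g $ 0)"
      by (simp add: fps_eq_iff fps_X_mult_nth)
    have "\<sigma> g - (g oo \<sigma> fps_X) = \<sigma> fps_X * (\<sigma> (fps_shift 1 g) - (fps_shift 1 g oo \<sigma> fps_X))"
      by (subst (1 2) g) (simp add: add mult const fps_compose_add_distrib
          fps_compose_mult_distrib[OF s0] fps_X_fps_compose_startby0[OF s0] right_diff_distrib)
    with Suc show ?case
      by (metis mult_dvd_mono dvd_refl power_Suc)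
  qed simp
  then obtain h where h: "\<sigma> g - (g oo \<sigma> fps_X) = \<sigma> fps_X ^ Suc n * h"
    by (meson dvdE)
  have "(\<sigma> fps_X ^ Suc n * h) $ n = 0"
  proof (cases "\<sigma> fps_X ^ Suc n * h = 0")
    case False
    with s0 have "subdegree (\<sigma> fps_X) > 0" by (simp add: subdegree_pos_iff)
    then have "Suc n * 1 \<le> Suc n * subdegree (\<sigma> fps_X)" by (intro mult_le_mono2) simp
    then have "n < subdegree (\<sigma> fps_X ^ Suc n)" unfolding subdegree_power by simp
    with False show ?thesis by (intro nth_less_subdegree_zero) auto
  qed (simp only: fps_zero_nth)
  with h show "\<sigma> g $ n = (g oo \<sigma> fps_X) $ n"
    by (metis eq_iff_diff_eq_0 fps_sub_nth)
qed

text \<open>Turns \<open>act\<close> into a substitution, so that the laws of a field homomorphism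
  follow from those of composition of series.\<close>

lemma act_eq_compose:
  assumes "\<sigma> \<in> nottingham"
  shows "act \<sigma> f = fls_compose_fps f (\<sigma> fps_X)"
  unfolding act_def fls_compose_fps_def by (subst nottingham_compose[OF assms]) simp

lemma nottingham_X:
  assumes "\<sigma> \<in> nottingham"
  shows "\<sigma> fps_X $ 0 = 0" "\<sigma> fps_X $ 1 = 1" "\<sigma> fps_X \<noteq> 0" "subdegree (\<sigma> fps_X) = 1"
proof -
  show 0: "\<sigma> fps_X $ 0 = 0" "\<sigma> fps_X $ 1 = 1" using assms by (auto simp: nottingham_def)
  then show "\<sigma> fps_X \<noteq> 0" by auto
  show "subdegree (\<sigma> fps_X) = 1" by (rule subdegreeI) (use 0 in auto)
qed

context
  fixes \<sigma> :: "'k::field fps \<Rightarrow> 'k fps"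
  assumes nott: "\<sigma> \<in> nottingham"
begin

lemma act_0: "act \<sigma> 0 = 0"
  and act_1: "act \<sigma> 1 = 1"
  and act_const: "act \<sigma> (fls_const c) = fls_const c"
  and act_add: "act \<sigma> (f + g) = act \<sigma> f + act \<sigma> g"
  and act_diff: "act \<sigma> (f - g) = act \<sigma> f - act \<sigma> g"
  and act_uminus: "act \<sigma> (- f) = - act \<sigma> f"
  and act_mult: "act \<sigma> (f * g) = act \<sigma> f * act \<sigma> g"
  and act_power: "act \<sigma> (f ^ n) = act \<sigma> f ^ n"
  and act_inverse: "act \<sigma> (inverse f) = inverse (act \<sigma> f)"
  and act_eq_0_iff: "act \<sigma> f = 0 \<longleftrightarrow> f = 0"
  using nottingham_X[OF nott]
  by (simp_all add: act_eq_compose[OF nott] fls_compose_fps_add fls_compose_fps_diff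
      fls_compose_fps_mult fls_compose_fps_power fls_compose_fps_inverse
      fls_compose_fps_eq_0_iff)

lemma act_fps_to_fls: "act \<sigma> (fps_to_fls h) = fps_to_fls (\<sigma> h)"
  using nottingham_X[OF nott] nottingham_compose[OF nott, of h]
  by (simp add: act_eq_compose[OF nott])

lemma act_subdegree: "fls_subdegree (act \<sigma> f) = fls_subdegree f"
proof (cases "f = 0")
  case False
  have "fls_base_factor_to_fps f oo \<sigma> fps_X \<noteq> 0"
    using fls_base_factor_to_fps_nonzero[OF False] nottingham_X[OF nott]
    by (simp add: fps_compose_eq_0_iff)
  moreover have "subdegree (fls_base_factor_to_fps f oo \<sigma> fps_X) = 0"
    using fls_base_factor_to_fps_base[OF False] by (intro subdegree_eq_0) simp
  ultimately show ?thesis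
    using nottingham_X[OF nott]
    by (simp add: act_eq_compose[OF nott] fls_compose_fps_def fls_subdegree_fls_to_fps)
qed (simp add: act_0)

text \<open>The leading coefficient is \<open>fls_base_factor_to_fps f $ 0\<close>, which is multiplicative in \<open>f\<close>.\<close>
lemma act_lead:
  "act \<sigma> f $$ fls_subdegree f = f $$ fls_subdegree f"
proof (cases "f = 0")
  case False
  define l where "l g = fls_base_factor_to_fps g $ 0" for g :: "'k fls"
  have l: "l g = g $$ fls_subdegree g" for g by (simp add: l_def)
  have mult: "l (g * h) = l g * l h" for g h
    unfolding l_def fls_base_factor_to_fps_mult by (rule fps_mult_nth_0)
  have inv: "l (inverse g) = inverse (l g)" for g
    unfolding l_def fls_base_factor_to_fps_inverse by simp
  have pow: "l (g ^ n) = l g ^ n" for g n by (induction n) (auto simp: mult, simp add: l)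
  \<comment> \<open>The normalization \<open>\<sigma> fps_X $ 1 = 1\<close> enters here: all powers
    of \<open>\<sigma> fps_X\<close> have leading coefficient 1.\<close>
  have "l (fps_to_fls (\<sigma> fps_X)) = 1"
    using nottingham_X[OF nott] by (simp add: l fls_subdegree_fls_to_fps)
  then have "l (fps_to_fls (\<sigma> fps_X) powi n) = 1" for n
    by (simp add: power_int_def pow inv)
  moreover have "l (fps_to_fls (fls_base_factor_to_fps f oo \<sigma> fps_X)) = l f"
  proof -
    have "subdegree (fls_base_factor_to_fps f oo \<sigma> fps_X) = 0"
      using fls_base_factor_to_fps_base[OF False] by (intro subdegree_eq_0) simp
    then show ?thesis by (simp add: l fls_subdegree_fls_to_fps)
  qed
  ultimately have "l (act \<sigma> f) = l f"
    by (simp add: act_eq_compose[OF nott] fls_compose_fps_def mult)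
  then show ?thesis by (simp add: l act_subdegree)
qed (simp add: act_0)

text \<open>Order and leading coefficient are preserved, so the leading terms cancel. This gives the
  cocycle values smaller poles than the generators have.\<close>

lemma act_diff_subdegree:
  assumes "act \<sigma> f \<noteq> f"
  shows "fls_subdegree (act \<sigma> f - f) > fls_subdegree f"
proof (rule fls_subdegree_greaterI)
  fix k assume "k \<le> fls_subdegree f"
  then show "(act \<sigma> f - f) $$ k = 0"
    by (cases "k = fls_subdegree f") (auto simp: act_lead fls_eq0_below_subdegree act_subdegree)
qed (use assms in simp)

end

text \<open>Substitution reverses composition, but \<open>\<sigma> (\<tau> fps_X)\<close> is itself
  \<open>\<tau> fps_X oo \<sigma> fps_X\<close>; the two reversals cancel and a left action
  results.\<close>

lemma act_comp:
  assumes "\<sigma> \<in> nottingham" "\<tau> \<in> nottingham" "\<sigma> \<circ> \<tau> \<in> nottingham"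
  shows "act (\<sigma> \<circ> \<tau>) f = act \<sigma> (act \<tau> f)"
proof -
  have "act \<sigma> (act \<tau> f) = fls_compose_fps f (\<tau> fps_X oo \<sigma> fps_X)"
    using nottingham_X[OF assms(1)] nottingham_X[OF assms(2)]
    by (simp add: act_eq_compose assms fls_compose_fps_assoc)
  also have "\<tau> fps_X oo \<sigma> fps_X = (\<sigma> \<circ> \<tau>) fps_X"
    using nottingham_compose[OF assms(1), of "\<tau> fps_X"] by simp
  finally show ?thesis by (simp only: act_eq_compose assms)
qed

lemma act_id: "act id f = f"
  unfolding act_def id_apply fps_to_fls_base_factor_to_fps fps_X_to_fls fls_X_power_int
  by (rule fls_base_factor_X_power_decompose(1)[symmetric])

section \<open>Binomial series in positive characteristic\<close>

text \<open>The local ring of \<open>rat\<close> at the characteristic of \<open>'k\<close>, on which \<open>reduce_rat\<close> is a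
  ring homomorphism.\<close>
definition reducible :: "'k::field itself \<Rightarrow> rat set" where
  "reducible _ = {of_int a / of_int b | a b. (of_int b :: 'k) \<noteq> 0}"

text \<open>Any denominator that is nonzero in \<open>'k\<close> may be used, not only the one in
  lowest terms; this makes sums and products easy to reduce.\<close>

lemma reduce_rat_fraction:
  assumes "(of_int b :: 'k::field) \<noteq> 0"
  shows "reduce_rat (of_int a / of_int b) = (of_int a / of_int b :: 'k)"
proof -
  define q :: rat where "q = of_int a / of_int b"
  obtain c d where cd: "quotient_of q = (c, d)" by force
  have d: "d > 0" "coprime c d" "q = of_int c / of_int d"
    using quotient_of_denom_pos[OF cd] quotient_of_coprime[OF cd] quotient_of_div[OF cd] by auto
  have "b \<noteq> 0" using assms by auto
  with d have "(of_int (c * b) :: rat) = of_int (a * d)"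
    by (simp add: q_def field_simps)
  then have "c * b = a * d" by (simp only: of_int_eq_iff)
  then have eq: "(of_int c * of_int b :: 'k) = of_int a * of_int d"
    by (metis of_int_mult)
  \<comment> \<open>If the reduced denominator vanished in \<open>'k\<close>, so would the
    numerator, and a Bezout identity for the coprime pair would give 1 = 0.\<close>
  have "(of_int d :: 'k) \<noteq> 0"
  proof
    assume 0: "(of_int d :: 'k) = 0"
    with eq assms have "(of_int c :: 'k) = 0" by simp
    moreover obtain u v where "u * c + v * d = 1"
      using bezout_int[of c d] \<open>coprime c d\<close> by auto
    then have "(of_int u * of_int c + of_int v * of_int d :: 'k) = 1"
      by (metis of_int_add of_int_mult of_int_1)
    ultimately show False using 0 by simp
  qed
  with eq assms show ?thesis
    by (simp add: reduce_rat_def cd flip: q_def) (simp add: field_simps)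
qed

lemma reducibleE:
  assumes "q \<in> reducible TYPE('k::field)"
  obtains a b where "q = of_int a / of_int b" "(of_int b :: 'k) \<noteq> 0"
    "(of_int b :: rat) \<noteq> 0" "reduce_rat q = (of_int a / of_int b :: 'k)"
proof -
  from assms obtain a b where "q = of_int a / of_int b" "(of_int b :: 'k) \<noteq> 0"
    by (auto simp: reducible_def)
  moreover from this have "b \<noteq> 0" by auto
  ultimately show thesis using that reduce_rat_fraction by auto
qed

lemma reducible_fraction: "(of_int b :: 'k::field) \<noteq> 0 \<Longrightarrow> of_int a / of_int b \<in> reducible TYPE('k)"
  by (auto simp: reducible_def)

lemma reducible_of_int: "of_int a \<in> reducible TYPE('k::field)"
  and reduce_rat_of_int: "reduce_rat (of_int a) = (of_int a :: 'k)"
  using reducible_fraction[of 1 a] reduce_rat_fraction[of 1 a, where 'k = 'k] by auto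

lemma
  assumes "x \<in> reducible TYPE('k::field)" "y \<in> reducible TYPE('k)"
  shows reducible_add: "x + y \<in> reducible TYPE('k)"
    and reduce_rat_add: "reduce_rat (x + y) = (reduce_rat x + reduce_rat y :: 'k)"
    and reducible_mult: "x * y \<in> reducible TYPE('k)"
    and reduce_rat_mult: "reduce_rat (x * y) = (reduce_rat x * reduce_rat y :: 'k)"
proof -
  from assms(1) obtain a b where x: "x = of_int a / of_int b" "(of_int b :: 'k) \<noteq> 0"
    "(of_int b :: rat) \<noteq> 0" "reduce_rat x = (of_int a / of_int b :: 'k)" by (rule reducibleE)
  from assms(2) obtain c d where y: "y = of_int c / of_int d" "(of_int d :: 'k) \<noteq> 0"
    "(of_int d :: rat) \<noteq> 0" "reduce_rat y = (of_int c / of_int d :: 'k)" by (rule reducibleE)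
  have sum: "x + y = of_int (a * d + c * b) / of_int (b * d)"
    and prod: "x * y = of_int (a * c) / of_int (b * d)"
    using x y by (simp_all add: field_simps)
  have nz: "(of_int (b * d) :: 'k) \<noteq> 0" using x y by simp
  show "x + y \<in> reducible TYPE('k)" "x * y \<in> reducible TYPE('k)"
    unfolding sum prod using nz by (rule reducible_fraction)+
  show "reduce_rat (x + y) = (reduce_rat x + reduce_rat y :: 'k)"
    unfolding sum reduce_rat_fraction[OF nz] using x y by (simp add: field_simps)
  show "reduce_rat (x * y) = (reduce_rat x * reduce_rat y :: 'k)"
    unfolding prod reduce_rat_fraction[OF nz] using x y by (simp add: field_simps)
qed

lemma
  assumes "\<And>i. i \<in> A \<Longrightarrow> f i \<in> reducible TYPE('k::field)"
  shows reducible_sum: "sum f A \<in> reducible TYPE('k)"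
    and reduce_rat_sum: "reduce_rat (sum f A) = (\<Sum>i\<in>A. reduce_rat (f i) :: 'k)"
proof -
  have "sum f A \<in> reducible TYPE('k) \<and> reduce_rat (sum f A) = (\<Sum>i\<in>A. reduce_rat (f i) :: 'k)"
    using assms
    by (induction A rule: infinite_finite_induct)
       (use reducible_of_int[of 0] reduce_rat_of_int[of 0]
         in \<open>auto simp: reducible_add reduce_rat_add\<close>)
  then show "sum f A \<in> reducible TYPE('k)"
    "reduce_rat (sum f A) = (\<Sum>i\<in>A. reduce_rat (f i) :: 'k)" by auto
qed

definition reduce_fps :: "rat fps \<Rightarrow> 'k::field fps" where
  "reduce_fps f = Abs_fps (\<lambda>n. reduce_rat (f $ n))"

lemma reduce_fps_1: "reduce_fps 1 = 1"
  using reduce_rat_of_int[of 1] reduce_rat_of_int[of 0]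
  by (auto simp: reduce_fps_def fps_eq_iff)

lemma
  assumes "\<And>n. f $ n \<in> reducible TYPE('k::field)" "\<And>n. g $ n \<in> reducible TYPE('k)"
  shows reducible_fps_mult: "(f * g) $ n \<in> reducible TYPE('k)"
    and reduce_fps_mult: "reduce_fps (f * g) = (reduce_fps f * reduce_fps g :: 'k fps)"
  using assms
  by (auto simp: reduce_fps_def fps_eq_iff fps_mult_nth reducible_sum reducible_mult
      reduce_rat_sum reduce_rat_mult)

lemma
  assumes "\<And>n. f $ n \<in> reducible TYPE('k::field)"
  shows reducible_fps_power: "(f ^ m) $ n \<in> reducible TYPE('k)"
    and reduce_fps_power: "reduce_fps (f ^ m) = (reduce_fps f ^ m :: 'k fps)"
proof -
  have "(\<forall>n. (f ^ m) $ n \<in> reducible TYPE('k)) \<and> reduce_fps (f ^ m) = (reduce_fps f ^ m :: 'k fps)"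
  proof (induction m)
    case 0
    then show ?case using reducible_of_int[of 1] reducible_of_int[of 0] by (auto simp: reduce_fps_1)
  next
    case (Suc m)
    then show ?case using assms by (auto simp: reducible_fps_mult reduce_fps_mult)
  qed
  then show "(f ^ m) $ n \<in> reducible TYPE('k)" "reduce_fps (f ^ m) = (reduce_fps f ^ m :: 'k fps)"
    by auto
qed

text \<open>Modulo \<open>fps_X ^ (n + 1)\<close> the power is
  \<open>T ^ m + m * T ^ (m - 1) * fps_X ^ n * D\<close>, and \<open>T\<close> has constant term
  1.\<close>

lemma fps_power_perturb_nth:
  fixes T D :: "'a::comm_ring_1 fps"
  assumes "n > 0" "T $ 0 = 1"
  shows "((T + fps_X ^ n * D) ^ m) $ n = (T ^ m) $ n + of_nat m * D $ 0"
proof -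
  have 0: "((T + fps_X ^ n * D) ^ m) $ 0 = 1" for m
    using assms by (simp add: fps_power_zeroth zero_power)
  show ?thesis
  proof (induction m)
    case (Suc m)
    have "((T + fps_X ^ n * D) ^ Suc m) $ n =
      (T * (T + fps_X ^ n * D) ^ m) $ n + (fps_X ^ n * (D * (T + fps_X ^ n * D) ^ m)) $ n"
      by (simp add: algebra_simps)
    also have "(fps_X ^ n * (D * (T + fps_X ^ n * D) ^ m)) $ n = D $ 0"
      using 0 by (simp add: fps_X_power_mult_nth)
    also have "(T * (T + fps_X ^ n * D) ^ m) $ n
      = (T ^ Suc m) $ n + of_nat m * D $ 0"
    proof -
      have eq: "((T + fps_X ^ n * D) ^ m) $ j = (T ^ m) $ j" if "j < n" for j
      proof -
        have "fps_X ^ n dvd (T + fps_X ^ n * D) ^ m - T ^ m"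
        proof (induction m)
          case (Suc m)
          have "(T + fps_X ^ n * D) ^ Suc m - T ^ Suc m
            = T * ((T + fps_X ^ n * D) ^ m - T ^ m) + fps_X ^ n * (D * (T + fps_X ^ n * D) ^ m)"
            by (simp add: algebra_simps)
          then show ?case using Suc by (simp add: dvd_add)
        qed simp
        then obtain h where "(T + fps_X ^ n * D) ^ m - T ^ m = fps_X ^ n * h" by (rule dvdE)
        then have "((T + fps_X ^ n * D) ^ m - T ^ m) $ j = 0"
          using that by (simp add: fps_X_power_mult_nth)
        then show ?thesis by simp
      qed
      have "(T * f) $ n = f $ n + (\<Sum>i = 1..n. T $ i * f $ (n - i))" for f
        using assms by (simp add: fps_mult_nth sum.atLeast_Suc_atMost)
      moreover have "(\<Sum>i = 1..n. T $ i * ((T + fps_X ^ n * D) ^ m) $ (n - i))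
        = (\<Sum>i = 1..n. T $ i * (T ^ m) $ (n - i))"
        using assms by (intro sum.cong) (auto simp: eq)
      ultimately show ?thesis using Suc by simp
    qed
    finally show ?case by (simp add: algebra_simps)
  qed simp
qed

text \<open>Comparing coefficients in the \<open>m\<close>-th power of the series, the \<open>n\<close>-th coefficient occurs
  linearly with factor \<open>m\<close>, which is invertible modulo the characteristic.\<close>
lemma gbinomial_reducible:
  assumes "of_nat m \<noteq> (0 :: 'k::field)"
  shows "((- 1 / of_nat m) gchoose n) \<in> reducible TYPE('k)"
proof (induction n rule: less_induct)
  case (less n)
  define B :: "rat fps" where "B = fps_binomial (- 1 / of_nat m)"
  have "m \<noteq> 0" using assms by (cases m) auto
  then have Bm: "B ^ m = inverse (1 + fps_X)"
    by (simp add: B_def fps_binomial_power flip: fps_binomial_minus_one)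
  show ?case
  proof (cases "n = 0")
    case True
    then show ?thesis using reducible_of_int[of 1] by simp
  next
    case False
    \<comment> \<open>Keeps only the coefficients below \<open>n\<close>, which the induction
      hypothesis covers; the others become 0.\<close>
    define T where "T = fps_cutoff n B"
    have "B = T + fps_X ^ n * fps_shift n B"
      unfolding T_def by (subst add.commute) (rule fps_shift_cutoff'[symmetric])
    moreover have "((T + fps_X ^ n * fps_shift n B) ^ m) $ n
        = (T ^ m) $ n + of_nat m * fps_shift n B $ 0"
      using False by (intro fps_power_perturb_nth) (auto simp: T_def B_def)
    ultimately have "(B ^ m) $ n = (T ^ m) $ n + of_nat m * B $ n" by simp
    moreover have "(B ^ m) $ n = of_int ((- 1) ^ n)"
      unfolding Bm fps_inverse_fps_X_plus1 by simp
    ultimately have "B $ n = (of_int ((- 1) ^ n) + of_int (- 1) * (T ^ m) $ n) * (of_int 1 / of_int (int m))"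
      using \<open>m \<noteq> 0\<close> by (simp add: field_simps)
    moreover have "(T ^ m) $ n \<in> reducible TYPE('k)"
    proof (rule reducible_fps_power)
      show "T $ j \<in> reducible TYPE('k)" for j
        using less reducible_of_int[of 0] by (auto simp: T_def B_def)
    qed
    ultimately have "B $ n \<in> reducible TYPE('k)"
      using assms by (auto simp only: intro!: reducible_mult reducible_add reducible_of_int reducible_fraction) simp
    then show ?thesis by (simp add: B_def)
  qed
qed

text \<open>The identity holds over the rationals. All coefficients lie in the local ring, so
  coefficientwise reduction, which respects products, carries it over to \<open>'k\<close>.\<close>

lemma binomial_series_power:
  assumes "of_nat m \<noteq> (0 :: 'k::field)"
  shows "binomial_series (- 1 / of_nat m) ^ m * (1 + fps_X) = (1 :: 'k fps)"
proof -
  define B :: "rat fps" where "B = fps_binomial (- 1 / of_nat m)"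
  have B: "B $ n \<in> reducible TYPE('k)" for n
    using gbinomial_reducible[OF assms] by (simp add: B_def)
  have "m \<noteq> 0" using assms by (cases m) auto
  then have prod: "B ^ m * (1 + fps_X) = 1"
    by (simp add: B_def fps_binomial_power fps_binomial_minus_one inverse_mult_eq_1)
  have X: "(1 + fps_X :: rat fps) $ n \<in> reducible TYPE('k)" for n
    using reducible_of_int[of 1] reducible_of_int[of 0] by (auto simp: fps_X_def)
  have "reduce_fps (1 + fps_X) = (1 + fps_X :: 'k fps)"
    using reduce_rat_of_int[of 1] reduce_rat_of_int[of 0]
    by (auto simp: reduce_fps_def fps_eq_iff fps_X_def)
  moreover have "reduce_fps B = (binomial_series (- 1 / of_nat m) :: 'k fps)"
    by (simp add: B_def reduce_fps_def binomial_series_def)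
  moreover have "reduce_fps (B ^ m * (1 + fps_X)) = (reduce_fps B ^ m * reduce_fps (1 + fps_X) :: 'k fps)"
    unfolding reduce_fps_mult[OF reducible_fps_power[OF B] X] reduce_fps_power[OF B] ..
  ultimately show ?thesis
    unfolding prod reduce_fps_1 by simp
qed

lemma binomial_series_nth_0: "binomial_series a $ 0 = (1 :: 'k::field)"
  using reduce_rat_of_int[of 1] by (simp add: binomial_series_def)

lemma binomial_series_compose_power:
  fixes x :: "'k::field fps"
  assumes "of_nat m \<noteq> (0 :: 'k)" "x $ 0 = 0"
  shows "(binomial_series (- 1 / of_nat m) oo x) ^ m * (1 + x) = 1"
proof -
  have "(binomial_series (- 1 / of_nat m) ^ m * (1 + fps_X)) oo x = (1 :: 'k fps)"
    unfolding binomial_series_power[OF assms(1)] by simp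
  then show ?thesis
    using assms(2) by (simp add: fps_compose_mult_distrib fps_compose_power fps_compose_add_distrib
        fps_X_fps_compose_startby0)
qed

text \<open>In the factorization of \<open>u ^ m - 1\<close> the cofactor of \<open>u - 1\<close>
  has constant term \<open>m\<close>, hence is nonzero.\<close>

lemma fps_root_of_unity_eq_1:
  fixes u :: "'k::field fps"
  assumes "of_nat m \<noteq> (0 :: 'k)" "u ^ m = 1" "u $ 0 = 1"
  shows "u = 1"
proof -
  have "(u - 1) * (\<Sum>i<m. u ^ i) = 0"
    using assms(2) by (simp flip: power_diff_1_eq)
  moreover have "(\<Sum>i<m. u ^ i) $ 0 = of_nat m"
    using assms(3) by (simp add: fps_sum_nth fps_power_zeroth)
  then have "(\<Sum>i<m. u ^ i) \<noteq> 0" using assms(1) by auto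
  ultimately show ?thesis by simp
qed

section \<open>Subrings, rational functions and places\<close>

text \<open>One notion serves the constants, valuation rings, subfields and sets of polynomials over
  them.\<close>

definition unital_subring :: "'a::ring_1 set \<Rightarrow> bool" where
  "unital_subring S \<longleftrightarrow> 1 \<in> S \<and> (\<forall>a\<in>S. \<forall>b\<in>S. a - b \<in> S \<and> a * b \<in> S)"

context
  fixes S :: "'a::ring_1 set"
  assumes S: "unital_subring S"
begin

lemma unital_subring_1: "1 \<in> S"
  and unital_subring_diff: "a \<in> S \<Longrightarrow> b \<in> S \<Longrightarrow> a - b \<in> S"
  and unital_subring_mult: "a \<in> S \<Longrightarrow> b \<in> S \<Longrightarrow> a * b \<in> S"
  using S by (auto simp: unital_subring_def)

lemma unital_subring_0: "0 \<in> S"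
  using unital_subring_diff[OF unital_subring_1 unital_subring_1] by simp

lemma unital_subring_uminus: "a \<in> S \<Longrightarrow> - a \<in> S"
  using unital_subring_diff[OF unital_subring_0] by fastforce

lemma unital_subring_add: "a \<in> S \<Longrightarrow> b \<in> S \<Longrightarrow> a + b \<in> S"
  using unital_subring_diff[OF _ unital_subring_uminus] by fastforce

lemma unital_subring_power: "a \<in> S \<Longrightarrow> a ^ n \<in> S"
  by (induction n) (auto intro: unital_subring_1 unital_subring_mult)

lemma unital_subring_sum: "(\<And>i. i \<in> A \<Longrightarrow> f i \<in> S) \<Longrightarrow> sum f A \<in> S"
  by (induction A rule: infinite_finite_induct) (auto intro: unital_subring_0 unital_subring_add)

lemmas unital_subring_intros = unital_subring_1 unital_subring_0 unital_subring_diff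
  unital_subring_mult unital_subring_uminus unital_subring_add unital_subring_power
  unital_subring_sum

end

lemma unital_subring_prod:
  fixes S :: "'a::comm_ring_1 set"
  shows "unital_subring S \<Longrightarrow> (\<And>i. i \<in> A \<Longrightarrow> f i \<in> S) \<Longrightarrow> prod f A \<in> S"
  by (induction A rule: infinite_finite_induct)
     (auto intro: unital_subring_1 unital_subring_mult)

lemma unital_subring_polys:
  fixes S :: "'a::comm_ring_1 set"
  assumes "unital_subring S"
  shows "unital_subring {p. \<forall>i. coeff p i \<in> S}"
  using assms
  by (auto simp: unital_subring_def[of "{p. _ p}"] coeff_mult coeff_1 intro!: unital_subring_intros)

lemma unital_subring_poly:
  fixes S :: "'a::comm_ring_1 set"
  assumes "unital_subring S" "\<forall>i. coeff p i \<in> S" "x \<in> S"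
  shows "poly p x \<in> S"
  unfolding poly_altdef using assms by (intro unital_subring_intros) auto

lemma subfield_subring: "is_k_subfield E \<Longrightarrow> unital_subring E"
  and subfield_const: "is_k_subfield E \<Longrightarrow> fls_const c \<in> E"
  and subfield_inverse: "is_k_subfield E \<Longrightarrow> a \<in> E \<Longrightarrow> inverse a \<in> E"
  and place_subring: "is_place E R \<Longrightarrow> unital_subring R"
  and place_const: "is_place E R \<Longrightarrow> fls_const c \<in> R"
  unfolding is_k_subfield_def unital_subring_def is_place_def
  by (auto simp flip: fls_const_1)

lemma consts_subring: "unital_subring (range fls_const :: 'k::field fls set)"
  unfolding unital_subring_def
  by (auto simp: fls_const_mult_const fls_minus_const simp flip: fls_const_1 intro!: rangeI)

section \<open>Rational functions in a single generator\<close>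

lemma k_adjoin_minimal: "is_k_subfield E \<Longrightarrow> x \<in> E \<Longrightarrow> k_adjoin x \<subseteq> E"
  by (auto simp: k_adjoin_def)

lemma k_adjoin_base: "x \<in> k_adjoin x"
  by (auto simp: k_adjoin_def)

lemma k_adjoin_subfield: "is_k_subfield (k_adjoin x)"
  unfolding k_adjoin_def is_k_subfield_def[of "\<Inter> _"]
  by (auto intro: subfield_const subfield_inverse unital_subring_diff unital_subring_mult
      subfield_subring)

text \<open>Polynomials over \<open>k\<close> are represented as polynomials over \<open>k((t))\<close> with constant coefficients.\<close>
definition const_polys :: "'k::field fls poly set" where
  "const_polys = {p. \<forall>i. coeff p i \<in> range fls_const}"

lemma const_polys_subring: "unital_subring (const_polys :: 'k::field fls poly set)"
  unfolding const_polys_def by (rule unital_subring_polys[OF consts_subring])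

lemma const_polys_pCons: "pCons a p \<in> const_polys \<longleftrightarrow> a \<in> range fls_const \<and> p \<in> const_polys"
  by (auto simp: const_polys_def coeff_pCons split: nat.splits)

lemma const_polys_coeff: "p \<in> const_polys \<Longrightarrow> (\<And>c. fls_const c \<in> S) \<Longrightarrow> coeff p i \<in> S"
  unfolding const_polys_def by (metis (mono_tags, lifting) mem_Collect_eq rangeE)

lemma poly_const_polys_in:
  assumes "unital_subring S" "\<And>c. fls_const c \<in> S" "p \<in> const_polys" "x \<in> S"
  shows "poly p x \<in> S"
  using assms by (intro unital_subring_poly allI const_polys_coeff)

text \<open>Since \<open>x\<close> has a pole, terms of different degree have different orders and
  the top one dominates. In particular \<open>x\<close> is transcendental over
  \<open>k\<close>.\<close>

lemma poly_const_polys_subdegree: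
  assumes "fls_subdegree x < 0" "p \<in> const_polys" "p \<noteq> 0"
  shows "poly p x \<noteq> 0 \<and> fls_subdegree (poly p x) = int (degree p) * fls_subdegree x"
  using assms(2,3)
proof (induction p)
  case (pCons a p)
  then obtain c where a: "a = fls_const c" by (auto simp: const_polys_pCons)
  have "x \<noteq> 0" using assms(1) by auto
  show ?case
  proof (cases "p = 0")
    case True
    with pCons show ?thesis by (simp add: a)
  next
    case False
    with pCons have IH: "poly p x \<noteq> 0" "fls_subdegree (poly p x) = int (degree p) * fls_subdegree x"
      by (auto simp: const_polys_pCons)
    have deg: "fls_subdegree (x * poly p x) = int (degree (pCons a p)) * fls_subdegree x"
      using IH \<open>x \<noteq> 0\<close> False by (simp add: algebra_simps)
    also have "\<dots> < 0" using assms(1) False by (simp add: mult_pos_neg)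
    finally have neg: "fls_subdegree (x * poly p x) < 0" .
    then have "fls_subdegree (a + x * poly p x) = fls_subdegree (x * poly p x)"
      using IH \<open>x \<noteq> 0\<close> by (intro fls_subdegree_add_eq2) (auto simp: a)
    with neg deg show ?thesis by (auto simp del: fls_subdegree_mult)
  qed
qed simp

text \<open>The quotients \<open>Q\<close> already form a subfield containing \<open>x\<close>;
  their denominators do not vanish because \<open>x\<close> has a pole.\<close>

lemma k_adjoin_quotient:
  fixes x :: "'k::field fls"
  assumes "fls_subdegree x < 0" "e \<in> k_adjoin x"
  obtains p q where "p \<in> const_polys" "q \<in> const_polys" "q \<noteq> 0" "e = poly p x / poly q x"
proof -
  define Q where "Q = {poly p x / poly q x | p q. p \<in> const_polys \<and> q \<in> const_polys \<and> q \<noteq> 0}"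
  note nz = poly_const_polys_subdegree[OF assms(1), THEN conjunct1]
  have QI: "poly p x / poly q x \<in> Q" if "p \<in> const_polys" "q \<in> const_polys" "q \<noteq> 0" for p q
    using that by (auto simp: Q_def)
  have 1: "1 \<in> const_polys" by (rule unital_subring_1[OF const_polys_subring])
  have "is_k_subfield Q"
    unfolding is_k_subfield_def
  proof (intro conjI ballI subsetI)
    fix a :: "'k fls" assume "a \<in> range fls_const"
    then show "a \<in> Q"
      using QI[of "[:a:]" 1] 1 by (auto simp: const_polys_pCons unital_subring_0[OF const_polys_subring])
  next
    fix a b assume "a \<in> Q" "b \<in> Q"
    then obtain p q p' q' where pq: "p \<in> const_polys" "q \<in> const_polys" "q \<noteq> 0" "a = poly p x / poly q x"
      "p' \<in> const_polys" "q' \<in> const_polys" "q' \<noteq> 0" "b = poly p' x / poly q' x"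
      by (auto simp: Q_def)
    have eq: "a - b = poly (p * q' - p' * q) x / poly (q * q') x" "a * b = poly (p * p') x / poly (q * q') x"
      using pq nz by (auto simp: diff_frac_eq)
    show "a - b \<in> Q" "a * b \<in> Q"
      unfolding eq using pq by (auto intro!: QI unital_subring_intros[OF const_polys_subring] simp del: poly_mult poly_diff)
  next
    fix a assume "a \<in> Q"
    then obtain p q where pq: "p \<in> const_polys" "q \<in> const_polys" "q \<noteq> 0" "a = poly p x / poly q x"
      by (auto simp: Q_def)
    show "inverse a \<in> Q"
    proof (cases "p = 0")
      case True
      then show ?thesis using pq QI[of 0 1] 1 unital_subring_0[OF const_polys_subring] by auto
    next
      case False
      then show ?thesis using pq QI[of q p] by simp
    qed
  qed
  moreover have "x \<in> Q"
  proof -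
    have "[:0, 1:] \<in> const_polys"
      using 1 fls_const_1 fls_const_0 by (auto simp: const_polys_pCons one_pCons intro: range_eqI[of _ _ 0])
    then show ?thesis using QI[of "[:0, 1:]" 1] 1 by simp
  qed
  ultimately have "e \<in> Q" using k_adjoin_minimal assms(2) by blast
  with that show thesis by (auto simp: Q_def)
qed

section \<open>Valuation rings, integrality and the place P\<close>

text \<open>Valuation rings are integrally closed: if \<open>inverse z\<close> is in
  \<open>R\<close>, dividing the equation by \<open>z ^ (n - 1)\<close> expresses \<open>z\<close>
  as a polynomial in \<open>inverse z\<close> with coefficients in \<open>R\<close>.\<close>

lemma integral_in_valuation_ring:
  assumes "unital_subring R" "z \<in> R \<or> inverse z \<in> R" "\<And>i. i < n \<Longrightarrow> b i \<in> R"
    and eq: "z ^ n = (\<Sum>i<n. b i * z ^ i)"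
  shows "(z :: 'a::field) \<in> R"
proof (cases "inverse z \<in> R \<and> z \<noteq> 0")
  case True
  define w where "w = inverse z"
  have w: "w \<in> R" "z \<noteq> 0" "w * z = 1" using True by (auto simp: w_def)
  obtain m where n: "n = Suc m" using eq by (cases n) auto
  have cancel: "z ^ i * w ^ m = w ^ (m - i)" if "i \<le> m" for i
  proof -
    have "w ^ m = w ^ (m - i) * w ^ i" using that by (simp flip: power_add)
    then show ?thesis using w(3) by (simp add: mult_ac flip: power_mult_distrib)
  qed
  have "z = z ^ n * w ^ m"
    using cancel[of m] by (simp add: n mult.assoc)
  also have "\<dots> = (\<Sum>i<n. b i * w ^ (m - i))"
    unfolding eq sum_distrib_right by (intro sum.cong) (auto simp: cancel mult.assoc n)
  also have "\<dots> \<in> R"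
    using assms(3) w by (intro unital_subring_intros[OF assms(1)]) auto
  finally show ?thesis .
qed (use assms unital_subring_0[OF assms(1)] in auto)

lemma place_P_iff: "f \<in> place_P F \<longleftrightarrow> f \<in> F \<and> fls_subdegree f \<ge> 0"
proof -
  have "f \<in> range fps_to_fls \<longleftrightarrow> fls_subdegree f \<ge> 0"
    by (metis fls_regpart_to_fls_trivial fls_subdegree_fls_to_fps_gt0 rangeE rangeI)
  then show ?thesis by (auto simp: place_P_def)
qed

lemma fls_subdegree_nonneg_mult:
  fixes f g :: "'k::field fls"
  shows "fls_subdegree f \<ge> 0 \<Longrightarrow> fls_subdegree g \<ge> 0 \<Longrightarrow> fls_subdegree (f * g) \<ge> 0"
  by (cases "f = 0 \<or> g = 0") auto

lemma fls_subdegree_nonneg_diff: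
  fixes f g :: "'k::field fls"
  assumes "fls_subdegree f \<ge> 0" "fls_subdegree g \<ge> 0"
  shows "fls_subdegree (f - g) \<ge> 0"
  using assms by (intro fls_subdegree_ge0I) (auto simp: fls_eq0_below_subdegree)

lemma place_P_subring: "is_k_subfield F \<Longrightarrow> unital_subring (place_P F)"
  using subfield_subring[of F]
  by (auto simp: unital_subring_def place_P_iff fls_subdegree_nonneg_mult fls_subdegree_nonneg_diff)

lemma fls_subdegree_inverse_field: "fls_subdegree (inverse f) = - fls_subdegree (f :: 'k::field fls)"
  by (cases "f = 0") (use fls_subdegree_power_int[of f "- 1"] in auto)

lemma max_ideal_place_P:
  assumes "is_k_subfield F" "is_k_subfield E" "E \<subseteq> F"
  shows "max_ideal (place_P F \<inter> E) = {a \<in> E. a = 0 \<or> fls_subdegree a > 0}"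
  using assms
  by (auto simp: max_ideal_def place_P_iff subfield_inverse fls_subdegree_inverse_field)

text \<open>After subtracting a constant, \<open>c\<close> vanishes at infinity; if then \<open>inverse c \<in> R\<close>, a
  representation of \<open>c\<close> as a quotient of polynomials shows that \<open>y\<close> is integral over \<open>R\<close>.\<close>
lemma k_adjoin_in_place_over_infinity:
  assumes y: "fls_subdegree y < 0" "y \<in> F" and R: "is_place F R" "y \<notin> R"
    and F: "is_k_subfield F" and c: "c \<in> k_adjoin y" "fls_subdegree c \<ge> 0"
  shows "c \<in> R"
proof -
  define e where "e = c - fls_const (c $$ 0)"
  note R' = place_subring[OF R(1)] place_const[OF R(1)]
  have eE: "e \<in> k_adjoin y"
    unfolding e_def using k_adjoin_subfield[of y] c
    by (intro unital_subring_diff subfield_subring subfield_const)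
  have "e \<in> R"
  proof (rule ccontr)
    assume "e \<notin> R"
    then have e0: "e \<noteq> 0" using unital_subring_0[OF R'(1)] by auto
    have "e \<in> F" using eE k_adjoin_minimal[OF F y(2)] by auto
    then have inv: "inverse e \<in> R" using R(1) \<open>e \<notin> R\<close> by (auto simp: is_place_def)
    have epos: "fls_subdegree e > 0"
    proof (rule fls_subdegree_greaterI[OF e0])
      fix k :: int assume "k \<le> 0"
      then show "e $$ k = 0"
        using c(2) by (cases "k = 0") (auto simp: e_def fls_eq0_below_subdegree)
    qed
    obtain p q where pq: "p \<in> const_polys" "q \<in> const_polys" "q \<noteq> 0" "e = poly p y / poly q y"
      using k_adjoin_quotient[OF y(1) eE] by blast
    have p0: "p \<noteq> 0" using pq e0 by auto
    note sp = poly_const_polys_subdegree[OF y(1) pq(1) p0]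
    note sq = poly_const_polys_subdegree[OF y(1) pq(2,3)]
    have "e * poly q y = poly p y" using sq pq by simp
    then have "fls_subdegree e + fls_subdegree (poly q y) = fls_subdegree (poly p y)"
      using e0 sq by (metis fls_subdegree_mult)
    \<comment> \<open>Positive order of \<open>e\<close> means a smaller pole in the numerator, and
      pole orders are the degrees times that of \<open>y\<close>.\<close>
    with sp sq epos have "int (degree q) * fls_subdegree y < int (degree p) * fls_subdegree y" by simp
    then have deg: "degree p < degree q" using y(1) by (simp add: mult_less_cancel_right)
    define l where "l = inverse (lead_coeff q)"
    have "lead_coeff q \<in> range fls_const" using pq(2) by (auto simp: const_polys_def)
    then obtain a where "lead_coeff q = fls_const a" by auto
    then have lR: "l \<in> R" using R'(2) by (simp add: l_def fls_inverse_const)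
    \<comment> \<open>Coefficients found by solving \<open>poly q y = inverse e * poly p y\<close>
      for the top power of \<open>y\<close>; the smaller degree of \<open>p\<close> keeps this
      equation monic.\<close>
    define b where "b i = l * (inverse e * coeff p i - coeff q i)" for i
    have "y \<in> R"
    proof (rule integral_in_valuation_ring[OF R'(1)])
      show "y \<in> R \<or> inverse y \<in> R" using y R by (auto simp: is_place_def)
      show "b i \<in> R" for i
      proof -
        have "coeff p i \<in> R" "coeff q i \<in> R" using pq R'(2) by (auto intro: const_polys_coeff)
        then show ?thesis unfolding b_def using lR inv by (intro unital_subring_intros[OF R'(1)])
      qed
      have p_sum: "poly p y = (\<Sum>i<degree q. coeff p i * y ^ i)"
        unfolding poly_altdef using deg
        by (intro sum.mono_neutral_left) (auto simp: coeff_eq_0)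
      have q_sum: "poly q y = lead_coeff q * y ^ degree q + (\<Sum>i<degree q. coeff q i * y ^ i)"
        unfolding poly_altdef lessThan_Suc_atMost[symmetric] by simp
      have "poly q y = inverse e * poly p y" using pq e0 sp by simp
      then have "lead_coeff q * y ^ degree q
          = inverse e * poly p y - (\<Sum>i<degree q. coeff q i * y ^ i)"
        unfolding q_sum by (rule iffD2[OF eq_diff_eq])
      also have "\<dots> = (\<Sum>i<degree q. (inverse e * coeff p i - coeff q i) * y ^ i)"
        by (simp only: p_sum sum_distrib_left left_diff_distrib sum_subtractf mult.assoc)
      finally have "lead_coeff q * y ^ degree q
          = (\<Sum>i<degree q. (inverse e * coeff p i - coeff q i) * y ^ i)" .
      then have "l * (lead_coeff q * y ^ degree q) = (\<Sum>i<degree q. b i * y ^ i)"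
        by (simp only: b_def sum_distrib_left mult.assoc)
      then show "y ^ degree q = (\<Sum>i<degree q. b i * y ^ i)"
        using pq(3) unfolding l_def mult.assoc[symmetric] by simp
    qed
    with R(2) show False by simp
  qed
  then have "e + fls_const (c $$ 0) \<in> R" by (rule unital_subring_add[OF R'(1) _ R'(2)])
  then show ?thesis by (simp add: e_def)
qed

section \<open>The invariant subfield\<close>

locale hkg =
  fixes G :: "('k::field fps \<Rightarrow> 'k fps) set" and F :: "'k fls set"
  assumes subgroup: "subgroup G nottingham_group"
    and finite: "finite G"
    and F: "is_k_subfield F"
    and stable: "\<sigma> \<in> G \<Longrightarrow> f \<in> F \<Longrightarrow> act \<sigma> f \<in> F"
    and dense: "\<exists>h. fps_to_fls h \<in> F \<and> (\<forall>j<n. h $ j = g $ j)"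
begin

lemma nott: "\<sigma> \<in> G \<Longrightarrow> \<sigma> \<in> nottingham"
  using subgroup.subset[OF subgroup] by (auto simp: nottingham_group_def)

lemma comp_closed: "\<sigma> \<in> G \<Longrightarrow> \<tau> \<in> G \<Longrightarrow> \<sigma> \<circ> \<tau> \<in> G"
  using subgroup.m_closed[OF subgroup, of \<sigma> \<tau>] by (simp add: nottingham_group_def)

lemma id_mem: "id \<in> G"
  using subgroup.one_closed[OF subgroup] by (simp add: nottingham_group_def)

lemma card_pos: "card G > 0"
  using finite id_mem by (auto simp: card_gt_0_iff)

lemma act_G_comp: "\<sigma> \<in> G \<Longrightarrow> \<tau> \<in> G \<Longrightarrow> act (\<sigma> \<circ> \<tau>) f = act \<sigma> (act \<tau> f)"
  by (simp add: act_comp nott comp_closed)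

lemma comp_bij:
  assumes "\<sigma> \<in> G"
  shows "bij_betw (\<lambda>\<tau>. \<sigma> \<circ> \<tau>) G G"
proof -
  have "inj \<sigma>" using nott[OF assms] by (auto simp: nottingham_def bij_is_inj)
  then have "inj_on (\<lambda>\<tau>. \<sigma> \<circ> \<tau>) G"
    by (auto intro!: inj_onI simp: fun_eq_iff inj_eq)
  moreover have "(\<lambda>\<tau>. \<sigma> \<circ> \<tau>) ` G \<subseteq> G" using comp_closed assms by auto
  ultimately show ?thesis
    using endo_inj_surj[OF finite] by (simp add: bij_betw_def)
qed

lemma inverse_exists:
  assumes "\<sigma> \<in> G"
  obtains \<tau> where "\<tau> \<in> G" "\<And>f. act \<sigma> (act \<tau> f) = f"
proof -
  have "id \<in> (\<lambda>\<tau>. \<sigma> \<circ> \<tau>) ` G"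
    using comp_bij[OF assms] id_mem by (simp add: bij_betw_def)
  then obtain \<tau> where "\<tau> \<in> G" "id = \<sigma> \<circ> \<tau>" by auto
  with that show thesis using act_G_comp[OF assms, of \<tau>] by (metis act_id)
qed

lemma fixed_subset: "fixed_field G F \<subseteq> F"
  by (auto simp: fixed_field_def)

lemma fixed_subfield: "is_k_subfield (fixed_field G F)"
  using F nott
  by (auto simp: is_k_subfield_def fixed_field_def act_const act_diff act_mult act_inverse)

text \<open>Applying \<open>act \<sigma>\<close> to all coefficients is a ring homomorphism on
  polynomials. It serves to show that the orbit polynomial is invariant.\<close>

lemma act_coeff_linear_prod:
  assumes "\<sigma> \<in> nottingham" "finite A"
  shows "act \<sigma> (coeff (\<Prod>\<tau>\<in>A. [:- h \<tau>, 1:]) i) = coeff (\<Prod>\<tau>\<in>A. [:- act \<sigma> (h \<tau>), 1:]) i"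
  using assms(2)
proof (induction A arbitrary: i rule: finite_induct)
  case empty
  then show ?case using assms(1) by (auto simp: coeff_1 act_1 act_0)
next
  case (insert a A)
  then show ?case
    by (cases i) (simp_all add: coeff_pCons act_add[OF assms(1)] act_diff[OF assms(1)]
        act_uminus[OF assms(1)] act_mult[OF assms(1)])
qed

text \<open>The \<open>c i\<close> are, up to sign, the elementary symmetric functions of the conjugates of \<open>z\<close>.\<close>
lemma orbit_equation:
  assumes S: "unital_subring S" and z: "\<And>\<sigma>. \<sigma> \<in> G \<Longrightarrow> act \<sigma> z \<in> S"
  obtains c where "\<And>i. c i \<in> S" "\<And>i \<sigma>. \<sigma> \<in> G \<Longrightarrow> act \<sigma> (c i) = c i"
    "z ^ card G = (\<Sum>i<card G. c i * z ^ i)"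
proof -
  define Q where "Q = (\<Prod>\<tau>\<in>G. [:- act \<tau> z, 1:])"
  have "Q \<in> {p. \<forall>i. coeff p i \<in> S}"
    unfolding Q_def using z
    by (intro unital_subring_prod[OF unital_subring_polys[OF S]])
       (auto simp: coeff_pCons one_pCons split: nat.split intro: unital_subring_intros[OF S])
  then have QS: "coeff Q i \<in> S" for i by simp
  have Qfix: "act \<sigma> (coeff Q i) = coeff Q i" if "\<sigma> \<in> G" for \<sigma> i
  proof -
    have "act \<sigma> (coeff Q i) = coeff (\<Prod>\<tau>\<in>G. [:- act (\<sigma> \<circ> \<tau>) z, 1:]) i"
      unfolding Q_def act_coeff_linear_prod[OF nott[OF that] finite]
      using that by (simp add: act_G_comp cong: prod.cong)
    \<comment> \<open>Left translation by \<open>\<sigma>\<close> only permutes the factors.\<close>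
    also have "(\<Prod>\<tau>\<in>G. [:- act (\<sigma> \<circ> \<tau>) z, 1:]) = Q"
      unfolding Q_def using prod.reindex_bij_betw[OF comp_bij[OF that], of "\<lambda>\<tau>. [:- act \<tau> z, 1:]"] by simp
    finally show ?thesis .
  qed
  have deg: "degree Q = card G"
    unfolding Q_def by (subst degree_prod_eq_sum_degree) auto
  have lead: "coeff Q (card G) = 1"
    using lead_coeff_prod[of "\<lambda>\<tau>. [:- act \<tau> z, 1:]" G] deg by (simp add: Q_def)
  have "poly [:- act id z, 1:] z = 0" by (simp add: act_id)
  then have "poly Q z = 0"
    unfolding Q_def poly_prod using id_mem finite by (intro prod_zero) auto
  then have "z ^ card G + (\<Sum>i<card G. coeff Q i * z ^ i) = 0"
    using deg lead by (simp add: poly_altdef flip: lessThan_Suc_atMost) (simp add: add.commute)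
  then have "z ^ card G = (\<Sum>i<card G. - coeff Q i * z ^ i)"
    by (simp add: sum_negf eq_neg_iff_add_eq_0)
  then show thesis
    using that[of "\<lambda>i. - coeff Q i"] QS Qfix nott
    by (simp add: act_uminus unital_subring_uminus[OF S])
qed

text \<open>Density is used for two coefficients only: agreement with \<open>t\<close> in degrees 0
  and 1 forces order 1.\<close>

lemma uniformizer_exists: obtains \<pi> where "\<pi> \<in> F" "fls_subdegree \<pi> = 1"
proof -
  obtain h where h: "fps_to_fls h \<in> F" "\<forall>j<2. h $ j = fps_X $ j" using dense by blast
  then have "h $ 0 = 0" "h $ 1 = 1" by auto
  then have "subdegree h = 1" by (intro subdegreeI) auto
  with h that[of "fps_to_fls h"] show thesis by (simp add: fls_subdegree_fls_to_fps)
qed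

text \<open>The elements of \<open>place_P F\<close> are integral over the \<open>G\<close>-invariant ones, so \<open>place_P F\<close> is
  contained in, hence equal to, every place over infinity.\<close>
lemma generator_in_place:
  assumes y: "fixed_field G F = k_adjoin y" "fls_subdegree y < 0"
    and R: "is_place F R" "R \<noteq> place_P F"
  shows "y \<in> R"
proof (rule ccontr)
  assume "y \<notin> R"
  have yF: "y \<in> F" using y k_adjoin_base fixed_subset by blast
  note R' = place_subring[OF R(1)]
  have sub: "place_P F \<subseteq> R"
  proof
    fix z assume z: "z \<in> place_P F"
    have "act \<sigma> z \<in> place_P F" if "\<sigma> \<in> G" for \<sigma>
      using z that by (simp add: place_P_iff stable act_subdegree nott)
    then obtain c where c: "\<And>i. c i \<in> place_P F" "\<And>i \<sigma>. \<sigma> \<in> G \<Longrightarrow> act \<sigma> (c i) = c i"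
      "z ^ card G = (\<Sum>i<card G. c i * z ^ i)"
      using orbit_equation[OF place_P_subring[OF F]] by metis
    have "c i \<in> R" for i
    proof (rule k_adjoin_in_place_over_infinity[OF y(2) yF R(1) \<open>y \<notin> R\<close> F])
      show "c i \<in> k_adjoin y"
        using c(1,2) by (auto simp: place_P_iff fixed_field_def simp flip: y(1))
      show "fls_subdegree (c i) \<ge> 0" using c(1) by (simp add: place_P_iff)
    qed
    moreover have "z \<in> R \<or> inverse z \<in> R"
      using z R(1) by (auto simp: place_P_iff is_place_def)
    ultimately show "z \<in> R"
      using c(3) by (intro integral_in_valuation_ring[OF R', of z "card G" c])
  qed
  \<comment> \<open>The inclusion is strict, so \<open>R\<close> contains an element with a pole at
    P. Its powers absorb every pole and force \<open>R = F\<close>, although a place is a proper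
    subset.\<close>
  obtain r where r: "r \<in> R" "r \<notin> place_P F" using sub R(2) by blast
  then have "r \<in> F" using R(1) by (auto simp: is_place_def)
  with r have r: "r \<in> R" "r \<in> F" "fls_subdegree r < 0" by (auto simp: place_P_iff)
  have "z \<in> R" if "z \<in> F" for z
  proof (cases "z = 0")
    case False
    define n where "n = nat (- fls_subdegree z)"
    have "r \<noteq> 0" using r by auto
    have deg: "fls_subdegree (z * inverse r ^ n) = fls_subdegree z - int n * fls_subdegree r"
      using False \<open>r \<noteq> 0\<close> by (simp add: fls_subdegree_pow fls_subdegree_inverse_field)
    have "int n * 1 \<le> int n * (- fls_subdegree r)" using r by (intro mult_left_mono) auto
    moreover have "- fls_subdegree z \<le> int n" by (simp add: n_def)
    ultimately have "int n * fls_subdegree r \<le> fls_subdegree z" by simp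
    then have "z * inverse r ^ n \<in> place_P F"
      using F that r by (auto simp: place_P_iff deg intro!: unital_subring_intros[OF subfield_subring[OF F]] subfield_inverse)
    with sub have "z * inverse r ^ n \<in> R" by blast
    then have "z * inverse r ^ n * r ^ n \<in> R"
      by (rule unital_subring_mult[OF R' _ unital_subring_power[OF R' r(1)]])
    then show ?thesis using \<open>r \<noteq> 0\<close> by (simp add: mult.assoc flip: power_mult_distrib)
  qed (use unital_subring_0[OF R'] in simp)
  then show False using R by (auto simp: is_place_def)
qed

text \<open>If \<open>x\<close> has no pole at P, then \<open>1 / (x - x(P))\<close> generates the
  same field and has one.\<close>

lemma generator_with_pole:
  assumes "x \<notin> range fls_const" "fixed_field G F = k_adjoin x"
  obtains y where "fixed_field G F = k_adjoin y" "fls_subdegree y < 0"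
proof (cases "fls_subdegree x < 0")
  case False
  define d where "d = x - fls_const (x $$ 0)"
  have "d \<noteq> 0" using assms(1) by (auto simp: d_def)
  then have "fls_subdegree d > 0"
  proof (rule fls_subdegree_greaterI)
    fix k :: int assume "k \<le> 0"
    then show "d $$ k = 0"
      using False by (cases "k = 0") (auto simp: d_def fls_eq0_below_subdegree)
  qed
  have "inverse d \<in> k_adjoin x"
    unfolding d_def by (intro subfield_inverse unital_subring_diff subfield_subring subfield_const
        k_adjoin_subfield k_adjoin_base)
  then have "k_adjoin (inverse d) \<subseteq> k_adjoin x" by (intro k_adjoin_minimal k_adjoin_subfield)
  moreover have "inverse (inverse d) + fls_const (x $$ 0) \<in> k_adjoin (inverse d)"
    by (intro subfield_inverse unital_subring_add subfield_subring subfield_const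
        k_adjoin_subfield k_adjoin_base)
  then have "x \<in> k_adjoin (inverse d)" by (simp add: d_def)
  then have "k_adjoin x \<subseteq> k_adjoin (inverse d)" by (intro k_adjoin_minimal k_adjoin_subfield)
  ultimately show thesis
    using that[of "inverse d"] assms \<open>fls_subdegree d > 0\<close> by (simp add: fls_subdegree_inverse_field)
qed (use assms that in auto)

text \<open>Uniformizers of \<open>place_P F\<close> have order 1, those of its trace on
  \<open>k(y)\<close> have the order of \<open>1/y\<close>. Comparing orders in
  \<open>u = v * \<pi> ^ e\<close> with \<open>v\<close> a unit determines \<open>e\<close>, as the
  \<open>THE\<close> in the definition requires.\<close>

lemma ramification_index_generator:
  assumes y: "fixed_field G F = k_adjoin y" "fls_subdegree y < 0"
  shows "ramification_index (fixed_field G F) (place_P F) = nat (- fls_subdegree y)"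
proof -
  define E where "E = fixed_field G F"
  note E = fixed_subfield[folded E_def] fixed_subset[folded E_def]
  have maxP: "max_ideal (place_P F) = {a \<in> F. a = 0 \<or> fls_subdegree a > 0}"
    using max_ideal_place_P[OF F F] by (simp add: place_P_iff Int_absorb2 subset_iff)
  have maxE: "max_ideal (place_P F \<inter> E) = {a \<in> E. a = 0 \<or> fls_subdegree a > 0}"
    by (rule max_ideal_place_P[OF F E])
  obtain \<pi>0 where \<pi>0: "\<pi>0 \<in> F" "fls_subdegree \<pi>0 = 1" by (rule uniformizer_exists)
  have \<pi>0_nz: "\<pi>0 \<noteq> 0" using \<pi>0 by auto
  have yE: "y \<in> E" "y \<noteq> 0" using y k_adjoin_base by (auto simp: E_def)
  have invy: "inverse y \<in> E" by (intro subfield_inverse E yE)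
  have div_mem: "b * inverse c \<in> S" if "is_k_subfield S" "b \<in> S" "c \<in> S" for b c S
    using that by (intro unital_subring_mult subfield_inverse subfield_subring)
  have deg_pi: "fls_subdegree \<pi> = 1" if u: "uniformizer_of (place_P F) \<pi>" for \<pi>
  proof -
    have \<pi>: "\<pi> = 0 \<or> fls_subdegree \<pi> > 0" using u by (auto simp: uniformizer_of_def maxP)
    have "\<pi>0 \<in> max_ideal (place_P F)" using \<pi>0 by (simp add: maxP)
    then obtain b where b: "b \<in> place_P F" "\<pi>0 = b * \<pi>" using u unfolding uniformizer_of_def by blast
    then have "b \<noteq> 0" "\<pi> \<noteq> 0" using \<pi>0_nz by auto
    then have "fls_subdegree \<pi>0 = fls_subdegree b + fls_subdegree \<pi>" using b by simp
    with \<pi> \<open>\<pi> \<noteq> 0\<close> b(1) \<pi>0 show ?thesis by (simp add: place_P_iff)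
  qed
  have unif_pi: "uniformizer_of (place_P F) \<pi>0"
    unfolding uniformizer_of_def
  proof (intro conjI ballI)
    show "\<pi>0 \<in> max_ideal (place_P F)" using \<pi>0 by (simp add: maxP)
    fix a assume a: "a \<in> max_ideal (place_P F)"
    then have "a * inverse \<pi>0 \<in> place_P F"
      using \<pi>0 \<pi>0_nz div_mem[OF F] by (cases "a = 0") (auto simp: maxP place_P_iff fls_subdegree_inverse_field)
    then show "\<exists>b\<in>place_P F. a = b * \<pi>0" using \<pi>0_nz by (intro bexI[of _ "a * inverse \<pi>0"]) auto
  qed
  \<comment> \<open>Orders of nonzero elements of \<open>k(y)\<close> are multiples of the order of
    \<open>1/y\<close>, so a positive one is at least that order.\<close>
  have unif_y: "uniformizer_of (place_P F \<inter> E) (inverse y)"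
    unfolding uniformizer_of_def
  proof (intro conjI ballI)
    show "inverse y \<in> max_ideal (place_P F \<inter> E)" using y invy by (simp add: maxE fls_subdegree_inverse_field)
    fix a assume a: "a \<in> max_ideal (place_P F \<inter> E)"
    have "fls_subdegree (a * y) \<ge> 0"
    proof (cases "a = 0")
      case False
      have "a \<in> k_adjoin y" using a y by (simp add: maxE flip: E_def)
      then obtain p q where pq: "p \<in> const_polys" "q \<in> const_polys" "q \<noteq> 0" "a = poly p y / poly q y"
        by (rule k_adjoin_quotient[OF y(2)])
      have "p \<noteq> 0" using pq False by auto
      note sub = poly_const_polys_subdegree[OF y(2) pq(1) this] poly_const_polys_subdegree[OF y(2) pq(2,3)]
      have deg: "fls_subdegree a = (int (degree q) - int (degree p)) * (- fls_subdegree y)"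
        using sub unfolding pq(4) divide_inverse using fls_subdegree_inverse_field[of "poly q y"]
        by (subst fls_subdegree_mult) (auto simp: algebra_simps)
      have "fls_subdegree a > 0" using a False by (simp add: maxE)
      then have "int (degree q) - int (degree p) \<ge> 1"
        unfolding deg
        using y(2) by (simp add: mult_less_0_iff)
      then have "1 * (- fls_subdegree y) \<le> fls_subdegree a"
        unfolding deg using y(2) by (intro mult_right_mono) auto
      then show ?thesis using False yE by simp
    qed simp
    moreover have "a * y \<in> E" using a yE by (auto simp: maxE intro: unital_subring_mult subfield_subring E)
    ultimately have "a * y \<in> place_P F \<inter> E" using E by (auto simp: place_P_iff)
    then show "\<exists>b\<in>place_P F \<inter> E. a = b * inverse y" using yE by (intro bexI[of _ "a * y"]) auto
  qed
  define N where "N = nat (- fls_subdegree y)"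
  \<comment> \<open>Uniformizers of the same ring divide each other, so \<open>u\<close> and
    \<open>inverse y\<close> have equal order.\<close>
  have subE: "fls_subdegree u = int N" if u: "uniformizer_of (place_P F \<inter> E) u" for u
  proof -
    obtain b where b: "b \<in> place_P F" "inverse y = b * u"
      using u unif_y unfolding uniformizer_of_def by blast
    obtain b' where b': "b' \<in> place_P F" "u = b' * inverse y"
      using u unif_y unfolding uniformizer_of_def by blast
    have "b \<noteq> 0" "b' \<noteq> 0" "u \<noteq> 0" using yE b b' by auto
    then have "fls_subdegree (b * u) = fls_subdegree b + fls_subdegree u"
      "fls_subdegree (b' * inverse y) = fls_subdegree b' + fls_subdegree (inverse y)"
      using yE by simp_all
    then show ?thesis using b(1) b'(1) y(2) unfolding b(2)[symmetric] b'(2)[symmetric] by (simp add: place_P_iff N_def fls_subdegree_inverse_field)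
  qed
  show ?thesis
    unfolding ramification_index_def E_def[symmetric] N_def[symmetric]
  proof (rule the_equality)
    define v where "v = inverse y * inverse \<pi>0 ^ N"
    note FS = subfield_subring[OF F]
    have "inverse y \<in> F" "inverse \<pi>0 \<in> F" using \<pi>0 invy E subfield_inverse[OF F] by auto
    then have v: "v \<in> F" unfolding v_def
      by (rule unital_subring_mult[OF FS _ unital_subring_power[OF FS]])
    have "fls_subdegree v = 0"
      using yE \<pi>0 \<pi>0_nz y by (simp add: v_def N_def fls_subdegree_pow fls_subdegree_inverse_field)
    then have "v \<in> place_P F" "inverse v \<in> place_P F"
      using v by (auto simp: place_P_iff subfield_inverse F fls_subdegree_inverse_field)
    moreover have "v \<noteq> 0" using yE \<pi>0_nz by (simp add: v_def)
    moreover have "inverse y = v * \<pi>0 ^ N"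
      using \<pi>0_nz by (simp add: v_def mult.assoc flip: power_mult_distrib)
    ultimately show "\<exists>\<pi> u v. uniformizer_of (place_P F) \<pi> \<and> uniformizer_of (place_P F \<inter> E) u \<and>
     v \<in> place_P F \<and> v \<noteq> 0 \<and> inverse v \<in> place_P F \<and> u = v * \<pi> ^ N"
      using unif_pi unif_y by blast
  next
    fix e
    assume "\<exists>\<pi> u v. uniformizer_of (place_P F) \<pi> \<and> uniformizer_of (place_P F \<inter> E) u \<and>
     v \<in> place_P F \<and> v \<noteq> 0 \<and> inverse v \<in> place_P F \<and> u = v * \<pi> ^ e"
    then obtain \<pi> u v where *: "uniformizer_of (place_P F) \<pi>" "uniformizer_of (place_P F \<inter> E) u"
      "v \<in> place_P F" "v \<noteq> 0" "inverse v \<in> place_P F" "u = v * \<pi> ^ e" by blast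
    have "fls_subdegree v = 0" using * by (simp add: place_P_iff fls_subdegree_inverse_field)
    moreover have "\<pi> \<noteq> 0" using deg_pi[OF *(1)] by auto
    ultimately have "fls_subdegree u = int e"
      using * deg_pi[OF *(1)] by (simp add: fls_subdegree_pow)
    with subE[OF *(2)] show "e = N" by simp
  qed
qed

end

section \<open>Pole numbers, cocycles and the uniformizer\<close>

text \<open>Here \<open>y\<close> is the future \<open>f 0\<close>; the pole order is the one that
  total ramification at P dictates.\<close>

locale hkg_generator = hkg +
  fixes y
  assumes y_fixed: "fixed_field G F = k_adjoin y"
    and y_subdegree: "fls_subdegree y = - int (card G)"
begin

lemma y_neg: "fls_subdegree y < 0"
  using y_subdegree card_pos by simp

lemma y_nonzero: "y \<noteq> 0"
  using y_neg by auto

lemma y_F: "y \<in> F"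
  using y_fixed k_adjoin_base fixed_subset by blast

lemma regular_subring: "unital_subring (regular_outside_P F)"
  using subfield_subring[OF F] place_subring[of F]
  unfolding unital_subring_def regular_outside_P_def by blast

lemma regular_const: "fls_const c \<in> regular_outside_P F"
  by (auto simp: regular_outside_P_def subfield_const[OF F] intro: place_const)

lemma regular_y: "y \<in> regular_outside_P F"
  using generator_in_place[OF y_fixed y_neg] y_F by (simp add: regular_outside_P_def)

lemma regular_polys: "p \<in> const_polys \<Longrightarrow> poly p y \<in> regular_outside_P F"
  by (intro poly_const_polys_in regular_subring regular_const regular_y)

text \<open>Multiplying \<open>z\<close> by a common denominator of the coefficients of its orbit equation makes it
  integral over \<open>k[y]\<close>.\<close>
lemma regular_multiple:
  assumes z: "z \<in> F"
  obtains d where "d \<in> const_polys" "d \<noteq> 0" "poly d y * z \<in> regular_outside_P F"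
proof -
  define n where "n = card G"
  obtain c where c: "\<And>i. c i \<in> F" "\<And>i \<sigma>. \<sigma> \<in> G \<Longrightarrow> act \<sigma> (c i) = c i"
    "z ^ n = (\<Sum>i<n. c i * z ^ i)"
    using orbit_equation[OF subfield_subring[OF F], of z] stable z unfolding n_def by metis
  have "\<exists>p q. p \<in> const_polys \<and> q \<in> const_polys \<and> q \<noteq> 0 \<and> c i = poly p y / poly q y" for i
  proof -
    have "c i \<in> k_adjoin y" using c by (simp add: fixed_field_def flip: y_fixed)
    then show ?thesis by (rule k_adjoin_quotient[OF y_neg]) blast
  qed
  then obtain p q where pq: "\<And>i. p i \<in> const_polys" "\<And>i. q i \<in> const_polys" "\<And>i. q i \<noteq> 0"
    "\<And>i. c i = poly (p i) y / poly (q i) y" by metis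
  have q_nz: "poly (q i) y \<noteq> 0" for i
    using poly_const_polys_subdegree[OF y_neg pq(2,3)] by simp
  define d where "d = (\<Prod>i<n. q i)"
  have d: "d \<in> const_polys" "d \<noteq> 0"
    unfolding d_def using pq by (auto intro!: unital_subring_prod[OF const_polys_subring])
  define D where "D = poly d y"
  have DA: "D \<in> regular_outside_P F" unfolding D_def by (rule regular_polys[OF d(1)])
  have Dc: "D * c i \<in> regular_outside_P F" if "i < n" for i
  proof -
    have "d = q i * (\<Prod>j\<in>{..<n} - {i}. q j)"
      unfolding d_def using that by (intro prod.remove) auto
    then have "D * c i = poly (p i * (\<Prod>j\<in>{..<n} - {i}. q j)) y"
      using q_nz[of i] by (simp add: D_def pq(4))
    moreover have "p i * (\<Prod>j\<in>{..<n} - {i}. q j) \<in> const_polys"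
      by (intro unital_subring_mult unital_subring_prod const_polys_subring pq)
    ultimately show ?thesis by (simp only: regular_polys)
  qed
  \<comment> \<open>The orbit equation times \<open>D ^ n\<close>. Because \<open>i < n\<close>, one
    factor \<open>D\<close> is left over to clear the denominator of \<open>c i\<close>.\<close>
  have eq: "(D * z) ^ n = (\<Sum>i<n. (D ^ (n - i - 1) * (D * c i)) * (D * z) ^ i)"
  proof -
    have "(D * z) ^ n = (\<Sum>i<n. D ^ n * (c i * z ^ i))"
      by (simp add: power_mult_distrib c(3) sum_distrib_left)
    also have "\<dots> = (\<Sum>i<n. (D ^ (n - i - 1) * (D * c i)) * (D * z) ^ i)"
    proof (rule sum.cong)
      fix i assume "i \<in> {..<n}"
      then have "n = (n - i - 1) + 1 + i" by simp
      then have "D ^ n = D ^ (n - i - 1) * D * D ^ i" by (metis power_add power_one_right)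
      then show "D ^ n * (c i * z ^ i) = (D ^ (n - i - 1) * (D * c i)) * (D * z) ^ i"
        by (simp add: power_mult_distrib)
    qed simp
    finally show ?thesis .
  qed
  have DzF: "D * z \<in> F"
    using DA z by (auto simp: regular_outside_P_def intro: unital_subring_mult subfield_subring F)
  have "D * z \<in> R" if R: "is_place F R" "R \<noteq> place_P F" for R
  proof (rule integral_in_valuation_ring[OF place_subring[OF R(1)] _ _ eq])
    show "D * z \<in> R \<or> inverse (D * z) \<in> R" using DzF R(1) unfolding is_place_def by blast
    fix i assume "i < n"
    then have "D ^ (n - i - 1) * (D * c i) \<in> regular_outside_P F"
      by (intro unital_subring_mult[OF regular_subring] unital_subring_power[OF regular_subring] DA Dc)
    then show "D ^ (n - i - 1) * (D * c i) \<in> R" using R by (simp add: regular_outside_P_def)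
  qed
  then have "D * z \<in> regular_outside_P F" using DzF by (simp add: regular_outside_P_def)
  then show thesis using that[of d] d by (simp add: D_def)
qed

section \<open>Pole numbers\<close>

lemma polar_divisorI:
  assumes "f \<in> regular_outside_P F" "f \<noteq> 0" "fls_subdegree f = - int n"
  shows "has_polar_divisor F f n"
  using assms by (auto simp: has_polar_divisor_def)

text \<open>Makes \<open>enumerate\<close> a genuine increasing listing of the pole numbers; powers
  of \<open>y\<close> supply arbitrarily large ones.\<close>

lemma pole_numbers_infinite: "infinite {n. \<exists>f. has_polar_divisor F f n}"
proof -
  have "has_polar_divisor F (y ^ m) (m * card G)" for m
    using y_nonzero
    by (intro polar_divisorI unital_subring_power[OF regular_subring] regular_y)
       (auto simp: fls_subdegree_pow y_subdegree)
  moreover have "m \<le> m * card G" for m using card_pos by simp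
  ultimately show ?thesis
    unfolding infinite_nat_iff_unbounded_le by blast
qed

lemma pole_number_polar_divisor: "\<exists>f. has_polar_divisor F f (pole_number F i)"
  using enumerate_in_set[OF pole_numbers_infinite, of i] by (simp add: pole_number_def)

lemma pole_number_ge: "i \<le> pole_number F i"
  unfolding pole_number_def by (rule le_enumerate[OF pole_numbers_infinite])

text \<open>Multiplying a uniformizer by a suitable denominator gives two regular functions
  whose pole orders are consecutive.\<close>
lemma pole_number_not_dvd:
  assumes "p > 1"
  shows "\<exists>i. \<not> p dvd pole_number F i"
proof -
  obtain \<pi> where \<pi>: "\<pi> \<in> F" "fls_subdegree \<pi> = 1" by (rule uniformizer_exists)
  then obtain d where d: "d \<in> const_polys" "d \<noteq> 0" "poly d y * \<pi> \<in> regular_outside_P F"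
    using regular_multiple by blast
  \<comment> \<open>The pole order of \<open>y * poly d y\<close>; the extra factor \<open>y\<close>
    makes it positive even for constant \<open>d\<close>.\<close>
  define M where "M = (degree d + 1) * card G"
  have M: "M > 0" using card_pos by (simp add: M_def)
  note deg_d = poly_const_polys_subdegree[OF y_neg d(1,2)]
  have a: "has_polar_divisor F (y * poly d y) M"
    using deg_d y_nonzero
    by (intro polar_divisorI unital_subring_mult[OF regular_subring] regular_y regular_polys d)
       (auto simp: M_def y_subdegree algebra_simps)
  have "\<pi> \<noteq> 0" using \<pi> by auto
  then have "has_polar_divisor F (y * (poly d y * \<pi>)) (M - 1)"
    using deg_d y_nonzero \<pi> M
    by (intro polar_divisorI unital_subring_mult[OF regular_subring] regular_y d)
       (auto simp: M_def y_subdegree algebra_simps of_nat_diff)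
  moreover have "\<not> p dvd M \<or> \<not> p dvd (M - 1)"
  proof (rule ccontr)
    assume "\<not> (\<not> p dvd M \<or> \<not> p dvd (M - 1))"
    then have "p dvd M" "p dvd M - 1" by auto
    then have "p dvd M - (M - 1)" by (rule dvd_diff_nat)
    moreover have "M - (M - 1) = 1" using M by simp
    ultimately show False using assms by simp
  qed
  ultimately obtain n f where "\<not> p dvd n" "has_polar_divisor F f n" using a by blast
  moreover from this obtain i where "pole_number F i = n"
    unfolding pole_number_def using enumerate_Ex[OF pole_numbers_infinite, of n] by auto
  ultimately show ?thesis by blast
qed

lemma m_pole_not_dvd:
  assumes "CHAR('a) > 1"
  shows "\<not> CHAR('a) dvd m_pole F"
  unfolding m_pole_def r_index_def
  by (rule LeastI_ex[OF pole_number_not_dvd[OF assms]])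

section \<open>Stability of the spaces L(nP) and the cocycles\<close>

text \<open>\<open>\<sigma>\<close> permutes the places of \<open>F\<close> and fixes P. Regularity
  of \<open>act \<sigma> f\<close> at \<open>R\<close> is regularity of \<open>f\<close> at the
  pulled-back place \<open>R'\<close>.\<close>

lemma act_regular:
  assumes \<sigma>: "\<sigma> \<in> G" and f: "f \<in> regular_outside_P F"
  shows "act \<sigma> f \<in> regular_outside_P F"
proof -
  have fF: "f \<in> F" using f by (simp add: regular_outside_P_def)
  have "act \<sigma> f \<in> R" if R: "is_place F R" "R \<noteq> place_P F" for R
  proof -
    define R' where "R' = {a \<in> F. act \<sigma> a \<in> R}"
    note F' = subfield_subring[OF F] and R_sub = place_subring[OF R(1)]
    note n = nott[OF \<sigma>]
    obtain \<tau> where \<tau>: "\<tau> \<in> G" "\<And>g. act \<sigma> (act \<tau> g) = g" using inverse_exists[OF \<sigma>] by blast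
    obtain b where b: "b \<in> F" "b \<notin> R" using R(1) by (auto simp: is_place_def)
    have "is_place F R'"
      unfolding is_place_def
    proof (intro conjI ballI)
      have "act \<tau> b \<in> F" "act \<tau> b \<notin> R'" using b \<tau> stable by (auto simp: R'_def)
      then show "R' \<subset> F" by (auto simp: R'_def)
      show "range fls_const \<subseteq> R'"
        using subfield_const[OF F] place_const[OF R(1)] by (auto simp: R'_def act_const[OF n])
      fix a assume a: "a \<in> R'"
      fix b assume b: "b \<in> R'"
      show "a - b \<in> R'" "a * b \<in> R'"
        using a b unital_subring_diff[OF F'] unital_subring_diff[OF R_sub]
          unital_subring_mult[OF F'] unital_subring_mult[OF R_sub]
        by (auto simp: R'_def act_diff[OF n] act_mult[OF n])
    next
      fix a assume a: "a \<in> F"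
      then have "act \<sigma> a \<in> R \<or> inverse (act \<sigma> a) \<in> R"
        using stable[OF \<sigma>] R(1) by (auto simp: is_place_def)
      with a show "a \<in> R' \<or> inverse a \<in> R'"
        by (auto simp: R'_def act_inverse[OF n] subfield_inverse[OF F])
    qed
    \<comment> \<open>The action preserves orders, so transporting back along the inverse
      \<open>\<tau>\<close> would turn \<open>R\<close> into \<open>place_P F\<close> as
      well.\<close>
    moreover have "R' \<noteq> place_P F"
    proof
      assume eq: "R' = place_P F"
      have "a \<in> R \<longleftrightarrow> a \<in> place_P F" if a: "a \<in> F" for a
      proof -
        have "a \<in> R \<longleftrightarrow> act \<tau> a \<in> R'" using a \<tau> stable by (auto simp: R'_def)
        also have "\<dots> \<longleftrightarrow> a \<in> place_P F"
          unfolding eq using a \<tau>(1) stable by (simp add: place_P_iff act_subdegree nott)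
        finally show ?thesis .
      qed
      moreover have "R \<subseteq> F" "place_P F \<subseteq> F" using R(1) by (auto simp: is_place_def place_P_iff)
      ultimately show False using R(2) by blast
    qed
    ultimately show ?thesis using f by (auto simp: regular_outside_P_def R'_def)
  qed
  then show ?thesis using stable[OF \<sigma> fF] by (simp add: regular_outside_P_def)
qed

lemma act_LP: "\<sigma> \<in> G \<Longrightarrow> f \<in> LP F n \<Longrightarrow> act \<sigma> f \<in> LP F n"
  by (auto simp: LP_def act_regular act_subdegree nott act_0)

lemma act_diff_LP:
  assumes "\<sigma> \<in> G" "has_polar_divisor F f n" "n > 0"
  shows "act \<sigma> f - f \<in> LP F (n - 1)"
proof -
  have f: "f \<in> regular_outside_P F" "fls_subdegree f = - int n"
    using assms by (auto simp: has_polar_divisor_def)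
  have "act \<sigma> f - f \<in> regular_outside_P F"
    using act_regular[OF assms(1) f(1)] f(1) by (rule unital_subring_diff[OF regular_subring])
  moreover have "act \<sigma> f - f = 0 \<or> - int (n - 1) \<le> fls_subdegree (act \<sigma> f - f)"
    using act_diff_subdegree[OF nott[OF assms(1)], of f] f(2) assms(3)
    by (cases "act \<sigma> f = f") (auto simp: of_nat_diff)
  ultimately show ?thesis by (simp add: LP_def)
qed

text \<open>Formal: \<open>\<sigma> (\<tau> f) - f\<close> splits as
  \<open>\<sigma> (\<tau> f - f) + (\<sigma> f - f)\<close>. As \<open>f\<close> itself need not lie
  in \<open>M\<close>, the class in \<open>M\<close> need not be trivial.\<close>

lemma coboundary_cocycle:
  assumes "\<And>\<sigma> x. \<sigma> \<in> G \<Longrightarrow> x \<in> M \<Longrightarrow> act \<sigma> x \<in> M" "\<And>\<sigma>. \<sigma> \<in> G \<Longrightarrow> act \<sigma> f - f \<in> M"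
  shows "is_1_cocycle G M (\<lambda>\<sigma>. act \<sigma> f - f)"
  using assms by (auto simp: is_1_cocycle_def act_G_comp act_diff nott)

lemma act_y: "\<sigma> \<in> G \<Longrightarrow> act \<sigma> y = y"
  using k_adjoin_base[of y] by (simp add: fixed_field_def flip: y_fixed)

text \<open>For \<open>i = 0\<close> the only monomial is the empty product, whose weight 0 is below
  \<open>card G\<close>.\<close>

lemma monomial_span_0: "monomial_span G F f 0 = range fls_const"
proof -
  have m: "module (\<lambda>c g. fls_const c * g :: 'a fls)"
    by unfold_locales (auto simp: algebra_simps simp flip: fls_plus_const fls_const_mult_const)
  show ?thesis
    unfolding monomial_span_def using card_pos
    by (simp add: m_bar_def module.span_singleton[OF m])
qed

lemma m_bar_pos: "m_bar G F i > 0"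
  using card_pos pole_number_ge[of "Suc (c_index G F i)"] by (simp add: m_bar_def)

lemma m_bar_polar_divisor: "i > 0 \<Longrightarrow> \<exists>f. has_polar_divisor F f (m_bar G F i)"
  using pole_number_polar_divisor by (simp add: m_bar_def)

lemma hkg_generators_exist: "\<exists>f. hkg_generators G F f \<and> f 0 = y"
proof -
  define f where "f i = (if i = 0 then y else SOME g. has_polar_divisor F g (m_bar G F i))" for i
  \<comment> \<open>Every enumerated pole number is attained, so the choice succeeds at each
    index.\<close>
  have "has_polar_divisor F (f i) (m_bar G F i)" for i
  proof (cases "i = 0")
    case True
    then show ?thesis
      using polar_divisorI[OF regular_y y_nonzero y_subdegree] by (simp add: f_def m_bar_def)
  next
    case False
    then show ?thesis using someI_ex[OF m_bar_polar_divisor] by (simp add: f_def)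
  qed
  then have "hkg_generators G F f" by (simp add: hkg_generators_def y_fixed f_def)
  then show ?thesis by (intro exI[of _ f]) (simp add: f_def)
qed

end

section \<open>Roots of series and the transformed uniformizer\<close>

text \<open>Once a factor \<open>fps_X\<close> is removed from both series, their quotient is an
  \<open>m\<close>-th root of unity with constant term 1.\<close>

lemma fps_power_eq_imp_eq:
  fixes a b :: "'k::field fps"
  assumes m: "of_nat m \<noteq> (0 :: 'k)" and pow: "a ^ m = b ^ m"
    and lead: "a $ 0 = 0" "b $ 0 = 0" "a $ 1 = b $ 1" "b $ 1 \<noteq> 0"
  shows "a = b"
proof -
  define a' b' where "a' = fps_shift 1 a" "b' = fps_shift 1 b"
  have ab: "a = fps_X * a'" "b = fps_X * b'"
    using lead by (auto simp: a'_b'_def fps_eq_iff fps_X_mult_nth)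
  have b'0: "b' $ 0 \<noteq> 0" "a' $ 0 = b' $ 0" using lead by (auto simp: a'_b'_def)
  have "a' ^ m = b' ^ m" using pow by (simp add: ab power_mult_distrib)
  then have "(a' * inverse b') ^ m = (b' * inverse b') ^ m" by (simp add: power_mult_distrib)
  also have "b' * inverse b' = 1" using b'0 by (simp add: inverse_mult_eq_1')
  finally have "(a' * inverse b') ^ m = 1" by (simp only: power_one)
  moreover have "(a' * inverse b') $ 0 = 1"
    unfolding fps_mult_nth_0 fps_inverse_nth_0 using b'0 by simp
  ultimately have "a' * inverse b' = 1" by (rule fps_root_of_unity_eq_1[OF m])
  then have "a' * (inverse b' * b') = b'" unfolding mult.assoc[symmetric] by simp
  then have "a' = b'" unfolding inverse_mult_eq_1[OF b'0(1)] by simp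
  then show ?thesis by (simp add: ab)
qed

text \<open>Write \<open>\<phi>\<close> as \<open>t ^ (- m)\<close> times a unit \<open>g\<close>.
  Algebraic closedness provides a root for the constant term of \<open>g\<close>, the binomial
  series one for the remaining factor \<open>1 + x\<close>.\<close>

lemma uniformizer_root_exists:
  fixes \<phi> :: "'k::alg_closed_field fls"
  assumes m: "of_nat m \<noteq> (0 :: 'k)" and deg: "\<phi> \<noteq> 0" "fls_subdegree \<phi> = - int m"
  obtains t' where "fps_to_fls t' ^ m = inverse \<phi>" "t' $ 0 = 0" "t' $ 1 \<noteq> 0"
proof -
  have "m > 0" using m by (cases m) auto
  define g where "g = fls_base_factor_to_fps \<phi>"
  have g0: "g $ 0 \<noteq> 0" unfolding g_def by (rule fls_base_factor_to_fps_base[OF deg(1)])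
  obtain c where c: "c ^ m = inverse (g $ 0)" using nth_root_exists[OF \<open>m > 0\<close>] by blast
  have "c \<noteq> 0" using c g0 \<open>m > 0\<close> by (auto simp: zero_power)
  define x where "x = fps_const (inverse (g $ 0)) * g - 1"
  have x0: "x $ 0 = 0" using g0 by (simp add: x_def)
  define B where "B = (binomial_series (- 1 / of_nat m) oo x :: 'k fps)"
  have B: "B ^ m * (1 + x) = 1"
    unfolding B_def by (rule binomial_series_compose_power[OF m x0])
  have B0: "B $ 0 = 1" by (simp add: B_def binomial_series_nth_0)
  define t' where "t' = fps_X * (fps_const c * B)"
  have "t' ^ m * g = fps_X ^ m * (B ^ m * (fps_const (inverse (g $ 0)) * g))"
    by (simp add: t'_def power_mult_distrib fps_const_power c mult_ac)
  also have "fps_const (inverse (g $ 0)) * g = 1 + x" by (simp add: x_def)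
  finally have tg: "t' ^ m * g = fps_X ^ m" by (simp add: B)
  have "fls_X powi (- int m) * fls_X ^ m = (1 :: 'k fls)"
    by (simp add: power_int_minus del: fls_X_power_int)
  moreover have "\<phi> = fps_to_fls g * fls_X powi (- int m)"
    using fls_base_factor_X_power_decompose(1)[of \<phi>] deg(2)
    unfolding g_def fps_to_fls_base_factor_to_fps fls_X_power_int by simp
  ultimately have "\<phi> * fls_X ^ m = fps_to_fls g"
    by (simp only: mult.assoc mult_1_right)
  then have "fps_to_fls t' ^ m * (\<phi> * fls_X ^ m) = fls_X ^ m"
    by (metis tg fls_times_fps_to_fls fps_to_fls_power fps_X_to_fls)
  then have "fps_to_fls t' ^ m * \<phi> = 1" by (simp add: mult.assoc[symmetric])
  then have "fps_to_fls t' ^ m = inverse \<phi>" using deg(1) by (metis inverse_unique mult.commute)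
  moreover have "t' $ 0 = 0" "t' $ 1 \<noteq> 0" using \<open>c \<noteq> 0\<close> B0 by (auto simp: t'_def)
  ultimately show thesis by (rule that)
qed

text \<open>Expresses \<open>k[[t']] = k[[t]]\<close>; the compositional inverse of
  \<open>t'\<close> yields the preimages.\<close>

lemma range_compose_uniformizer:
  fixes t' :: "'k::field fps"
  assumes "t' $ 0 = 0" "t' $ 1 \<noteq> 0"
  shows "range (\<lambda>g. g oo t') = UNIV"
proof -
  have "h = (h oo fps_inv t') oo t'" for h
    using fps_compose_assoc[of t' "fps_inv t'" h] fps_inv[OF assms] assms(1)
    by (simp add: fps_inv_def)
  then show ?thesis by blast
qed

text \<open>Here \<open>1 + x\<close> is \<open>act \<sigma> \<phi> / \<phi>\<close>, so
  \<open>\<sigma> t' ^ m\<close>, the inverse of \<open>act \<sigma> \<phi>\<close>, equals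
  \<open>t' ^ m / (1 + x)\<close>. Comparing leading coefficients selects the right root.\<close>

lemma root_transformation:
  fixes \<phi> :: "'k::field fls"
  assumes \<sigma>: "\<sigma> \<in> nottingham" and m: "of_nat m \<noteq> (0 :: 'k)"
    and deg: "\<phi> \<noteq> 0" "fls_subdegree \<phi> = - int m"
    and t': "fps_to_fls t' ^ m = inverse \<phi>" "t' $ 0 = 0" "t' $ 1 \<noteq> 0"
  shows "\<exists>x. x $ 0 = 0 \<and> fps_to_fls x = (act \<sigma> \<phi> - \<phi>) * fps_to_fls t' ^ m \<and>
    \<sigma> t' = t' * (binomial_series (- 1 / of_nat m) oo x)"
proof -
  define e where "e = (act \<sigma> \<phi> - \<phi>) * fps_to_fls t' ^ m"
  \<comment> \<open>The difference has a pole of order below \<open>m\<close> while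
    \<open>t' ^ m\<close> has a zero of order \<open>m\<close>; hence \<open>e\<close> may be
    substituted into the binomial series.\<close>
  have e: "e = 0 \<or> fls_subdegree e > 0"
  proof (cases "act \<sigma> \<phi> = \<phi>")
    case False
    then show ?thesis
      using act_diff_subdegree[OF \<sigma> False] deg unfolding e_def t'(1)
      by (simp add: fls_subdegree_inverse_field)
  qed (simp add: e_def)
  define x where "x = fls_regpart e"
  have x: "fps_to_fls x = e" unfolding x_def using e by (intro fls_regpart_to_fls_trivial) auto
  have x0: "x $ 0 = 0" using e by (auto simp: x_def fls_eq0_below_subdegree)
  define B where "B = (binomial_series (- 1 / of_nat m) oo x :: 'k fps)"
  have B: "B ^ m * (1 + x) = 1"
    unfolding B_def by (rule binomial_series_compose_power[OF m x0])
  have B0: "B $ 0 = 1" by (simp add: B_def binomial_series_nth_0)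
  have "fps_to_fls (1 + x) = act \<sigma> \<phi> * inverse \<phi>"
    using deg(1) by (simp add: x e_def t'(1) algebra_simps)
  moreover have "fps_to_fls (\<sigma> t') ^ m = inverse (act \<sigma> \<phi>)"
    by (simp add: t'(1) act_inverse[OF \<sigma>] flip: act_fps_to_fls[OF \<sigma>] act_power[OF \<sigma>])
  ultimately have "fps_to_fls (\<sigma> t' ^ m * (1 + x)) = inverse \<phi>"
    using deg(1) act_eq_0_iff[OF \<sigma>, of \<phi>]
    by (simp add: fls_times_fps_to_fls fps_to_fls_power)
  then have "fps_to_fls (\<sigma> t' ^ m * (1 + x)) = fps_to_fls (t' ^ m)"
    by (simp add: t'(1) fps_to_fls_power)
  then have "\<sigma> t' ^ m * (1 + x) = t' ^ m" by (simp only: fps_to_fls_eq_iff)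
  also have "t' ^ m = (t' * B) ^ m * (1 + x)"
    by (simp add: power_mult_distrib mult.assoc B)
  \<comment> \<open>Cancels \<open>1 + x\<close>, which is nonzero by the fact
    \<open>B\<close>.\<close>
  finally have pow: "\<sigma> t' ^ m = (t' * B) ^ m" using B by auto
  have sub: "subdegree t' = 1" by (rule subdegreeI) (use t' in auto)
  have "(\<sigma> t') $ 1 = t' $ 1"
    using act_lead[OF \<sigma>, of "fps_to_fls t'"] by (simp add: act_fps_to_fls[OF \<sigma>] fls_subdegree_fls_to_fps sub)
  moreover have "(\<sigma> t') $ 0 = 0"
    using t'(2) by (subst nottingham_compose[OF \<sigma>]) simp
  moreover have "(t' * B) $ 1 = t' $ 1" "(t' * B) $ 0 = 0"
    using t'(2) B0 by (simp_all add: fps_mult_nth)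
  ultimately have "\<sigma> t' = t' * B"
    using t'(3) by (intro fps_power_eq_imp_eq[OF m pow]) auto
  with x x0 show ?thesis unfolding B_def e_def by blast
qed

text \<open>\<open>span_eq\<close> and \<open>m_bar_s\<close> state two facts recalled in the
  context: the monomial span equals \<open>L((m_i - 1)P)\<close> with \<open>m_i\<close> standing
  for \<open>m_bar G F i\<close>, and \<open>m_bar\<close> at index \<open>s\<close> is
  \<open>m\<close>. The series \<open>x\<close> is the cocycle value at \<open>s\<close> times
  \<open>t' ^ m\<close>, viewed in \<open>k[[t]]\<close>.\<close>

theorem theorem4:
  fixes G :: "('k::alg_closed_field fps \<Rightarrow> 'k fps) set"
    and F :: "'k fls set"
  assumes "CHAR('k) \<ge> 5"
    and "subgroup G nottingham_group"
    and "finite G"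
    and "\<exists>n. card G = CHAR('k) ^ n"
    and "hkg_cover G F"
    and span_eq: "\<And>f i. hkg_generators G F f \<Longrightarrow> 1 \<le> i \<Longrightarrow> i \<le> s_num G F \<Longrightarrow>
           monomial_span G F f i = LP F (m_bar G F i - 1)"
    and m_bar_s: "m_bar G F (s_num G F) = m_pole F"
  shows "\<exists>f C t'.
    hkg_generators G F f \<and>
    (\<forall>i\<le>s_num G F.
       is_1_cocycle G (monomial_span G F f i) (C i) \<and>
       (\<forall>\<sigma>\<in>G. act \<sigma> (f i) = f i + C i \<sigma>)) \<and>
    fps_to_fls t' ^ m_pole F = inverse (f (s_num G F)) \<and>
    subdegree t' = 1 \<and> range (\<lambda>g. g oo t') = UNIV \<and>
    (\<forall>\<sigma>\<in>G. \<exists>x. x $ 0 = 0 \<and>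
       fps_to_fls x = C (s_num G F) \<sigma> * fps_to_fls t' ^ m_pole F \<and>
       \<sigma> t' = t' * (binomial_series (- 1 / of_nat (m_pole F)) oo x))"
proof -
  have subfield: "is_k_subfield F" and G_stable: "\<forall>\<sigma>\<in>G. \<forall>f\<in>F. act \<sigma> f \<in> F"
    and rational: "\<exists>x. x \<notin> range fls_const \<and> fixed_field G F = k_adjoin x"
    and approx: "\<forall>g n. \<exists>h. fps_to_fls h \<in> F \<and> (\<forall>j<n. h $ j = g $ j)"
    and ram: "ramification_index (fixed_field G F) (place_P F) = card G"
    using assms(5) unfolding hkg_cover_def by simp_all
  interpret hkg G F
  proof (rule hkg.intro)
    show "\<exists>h. fps_to_fls h \<in> F \<and> (\<forall>j<n. h $ j = g $ j)" for n and g :: "'k fps"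
      using approx by simp
  qed (use assms(2,3) subfield G_stable in blast)+
  from rational obtain x where "x \<notin> range fls_const" "fixed_field G F = k_adjoin x"
    by blast
  then obtain y where y: "fixed_field G F = k_adjoin y" "fls_subdegree y < 0"
    by (rule generator_with_pole)
  \<comment> \<open>Total ramification at P fixes the pole order of the generator.\<close>
  have "nat (- fls_subdegree y) = card G"
    using ramification_index_generator[OF y] ram by simp
  with y interpret hkg_generator G F y
    using hkg_axioms by (intro hkg_generator.intro hkg_generator_axioms.intro) auto
  obtain f where f: "hkg_generators G F f" "f 0 = y" using hkg_generators_exist by blast
  define C where "C i \<sigma> = act \<sigma> (f i) - f i" for i \<sigma>
  define s m where "s = s_num G F" "m = m_pole F"
  have pole: "has_polar_divisor F (f i) (m_bar G F i)" if "i \<le> s" for i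
    using f(1) that by (simp add: hkg_generators_def s_m_def)
  have cocycle: "is_1_cocycle G (monomial_span G F f i) (C i)" if "i \<le> s" for i
  proof (cases "i = 0")
    case True
    \<comment> \<open>\<open>f 0 = y\<close> is invariant, so \<open>C 0\<close> vanishes.\<close>
    show ?thesis
      unfolding C_def True monomial_span_0 f(2)
      by (intro coboundary_cocycle) (auto simp: act_const nott act_y intro: range_eqI[of _ _ 0])
  next
    case False
    \<comment> \<open>For positive \<open>i\<close> the span becomes a space \<open>LP\<close>,
      which is \<open>G\<close>-stable and contains the differences because their poles are
      smaller.\<close>
    then have "monomial_span G F f i = LP F (m_bar G F i - 1)"
      using span_eq[OF f(1)] that by (simp add: s_m_def)
    then show ?thesis
      unfolding C_def using act_LP act_diff_LP[OF _ pole[OF that] m_bar_pos]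
      by (intro coboundary_cocycle) auto
  qed
  have m: "of_nat m \<noteq> (0 :: 'k)"
    using m_pole_not_dvd assms(1) by (simp add: of_nat_eq_0_iff_char_dvd s_m_def)
  have "m > 0" using m by (cases m) auto
  then have deg: "f s \<noteq> 0" "fls_subdegree (f s) = - int m"
    using pole[of s] m_bar_s by (auto simp: has_polar_divisor_def s_m_def)
  obtain t' where t': "fps_to_fls t' ^ m = inverse (f s)" "t' $ 0 = 0" "t' $ 1 \<noteq> 0"
    by (rule uniformizer_root_exists[OF m deg])
  have "subdegree t' = 1" by (rule subdegreeI) (use t' in auto)
  moreover have "\<exists>x. x $ 0 = 0 \<and> fps_to_fls x = C s \<sigma> * fps_to_fls t' ^ m \<and>
       \<sigma> t' = t' * (binomial_series (- 1 / of_nat m) oo x)" if "\<sigma> \<in> G" for \<sigma>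
    unfolding C_def by (rule root_transformation[OF nott[OF that] m deg t'])
  ultimately show ?thesis
    using f(1) cocycle t'(1) range_compose_uniformizer[OF t'(2,3)]
    unfolding s_m_def by (intro exI[of _ f] exI[of _ C] exI[of _ t']) (auto simp: C_def)
qed

end
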